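(* Let $n\ge1$ and let $S\in SO(2n)$ be distributed according to the Haar probability measure $\mu_{SO(2n)}$ on the special orthogonal group $SO(2n)$. Then $$\det(I_{2n}-S)\ \overset{\mathrm{law}}{=}\ 2\prod_{k=2}^{2n}\left(1+\epsilon_k\sqrt{\beta_{\frac12,\frac{k-1}{2}}}\right),$$ where $\epsilon_1,\dots,\epsilon_{2n},\beta_{\frac12,\frac12},\dots,\beta_{\frac12,\frac{2n-1}{2}}$ are independent random variables such that $\mathbb{P}(\epsilon_k=1)=\mathbb{P}(\epsilon_k=-1)=\frac12$ for each $k$, and each $\beta_{a,b}$ is beta distributed with the indicated parameters $a,b$.
   Context: $\overset{\mathrm{law}}{=}$ denotes equality in distribution. A beta random variable with parameters $a,b>0$ has density $\frac{\Gamma(a+b)}{\Gamma(a)\Gamma(b)}t^{a-1}(1-t)^{b-1}$ on $[0,1]$. *)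

theory Defs
  imports "HOL-Probability.Probability"
begin

definition special_orthogonal_group :: "(real ^ 'd ^ 'd) set"  where
  "special_orthogonal_group = {A. rotation_matrix A}"

definition SO_borel :: "(real ^ 'd ^ 'd) measure"  where
  "SO_borel = restrict_space borel special_orthogonal_group"

text \<open>
  Normalised Haar measure. Left invariance suffices: on the compact group SO(N) the
  left-invariant Borel probability measure exists, is unique, and is also right-invariant.
\<close>
definition haar_probability_SO :: "(real ^ 'd ^ 'd) measure \<Rightarrow> bool"  where
  "haar_probability_SO \<mu> \<longleftrightarrow>
     prob_space \<mu> \<and> sets \<mu> = sets SO_borel \<and>
     (\<forall>A\<in>special_orthogonal_group. distr \<mu> \<mu> (\<lambda>S. A ** S) = \<mu>)"

definition beta_density :: "real \<Rightarrow> real \<Rightarrow> real \<Rightarrow> real"  where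
  "beta_density a b t =
     (if 0 \<le> t \<and> t \<le> 1
      then Gamma (a + b) / (Gamma a * Gamma b) * t powr (a - 1) * (1 - t) powr (b - 1)
      else 0)"

end

theory Submission
  imports Defs
begin

text \<open>
  Haar measure on \<open>SO(N)\<close>, with \<open>N = 2n\<close>, is built up from reflections: let \<open>R\<^sub>k\<close> be the reflection taking
  \<open>e\<^sub>k\<close> to a uniform point \<open>v\<^sub>k\<close> of the unit sphere of \<open>span(e\<^sub>1, ..., e\<^sub>k)\<close>, obtained by normalising
  a projected Gaussian vector. With \<open>R\<^sub>1\<close> fixed as \<open>e\<^sub>1 \<mapsto> -e\<^sub>1\<close>, the product \<open>R\<^sub>k ... R\<^sub>1\<close> has
  determinant \<open>(-1)\<^sup>k\<close>, and its law is left invariant under \<open>SO(k)\<close>: if \<open>h\<close> is a rotation and \<open>R\<^sub>v\<close> takes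
  \<open>e\<^sub>k\<close> to \<open>v\<close>, then \<open>h R\<^sub>v = R\<^sub>h\<^sub>v h'\<close> with \<open>h' \<in> SO(k-1)\<close>. As a left invariant probability measure is unique,
  \<open>R\<^sub>N ... R\<^sub>1\<close> is Haar distributed. Column operations give
  \<open>det (I - R\<^sub>k W) = (1 - \<langle>e\<^sub>k, v\<^sub>k\<rangle>) det (I - W)\<close>, with determinants taken on \<open>span(e\<^sub>1, ..., e\<^sub>k)\<close> and
  \<open>span(e\<^sub>1, ..., e\<^sub>k\<^sub>-\<^sub>1)\<close>, for \<open>W\<close> fixing \<open>e\<^sub>k\<close>. Finally the coordinate \<open>\<langle>e\<^sub>k, v\<^sub>k\<rangle>\<close> has density
  proportional to \<open>(1 - u\<^sup>2) powr ((k - 3) / 2)\<close> on \<open>(-1, 1)\<close>, as has a random sign times the square root of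
  a \<open>\<beta>(1/2, (k-1)/2)\<close> variable.
\<close>

section \<open>Reflections and determinants\<close>

text \<open>In the Leibniz formula a permutation moving \<open>k\<close> picks a vanishing entry of
  row \<open>k\<close> in both matrices. A permutation fixing \<open>k\<close> never visits column
  \<open>k\<close> from another row, so the remaining factors agree. This acts as cofactor expansion
  without leaving the matrix type.\<close>

lemma det_row_isolated:
  fixes A B :: "real ^ 'd ^ 'd"
  assumes A: "\<And>j. j \<noteq> k \<Longrightarrow> A $ k $ j = 0" and B: "\<And>j. j \<noteq> k \<Longrightarrow> B $ k $ j = 0"
    and B1: "B $ k $ k = 1"
    and AB: "\<And>i j. i \<noteq> k \<Longrightarrow> j \<noteq> k \<Longrightarrow> A $ i $ j = B $ i $ j"
  shows "det A = A $ k $ k * det B"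
  unfolding det_def sum_distrib_left
proof (rule sum.cong[OF refl])
  fix p :: "'d \<Rightarrow> 'd" assume "p \<in> {p. p permutes UNIV}"
  then have inj: "inj p" by (simp add: permutes_inj)
  show "of_int (sign p) * (\<Prod>i\<in>UNIV. A $ i $ p i) = A $ k $ k * (of_int (sign p) * (\<Prod>i\<in>UNIV. B $ i $ p i))"
  proof (cases "p k = k")
    case True
    have "(\<Prod>i\<in>UNIV - {k}. A $ i $ p i) = (\<Prod>i\<in>UNIV - {k}. B $ i $ p i)"
    proof (rule prod.cong[OF refl])
      fix i assume "i \<in> UNIV - {k}"
      then have "i \<noteq> k" "p i \<noteq> k" using True inj by (auto dest: injD[of p i k])
      then show "A $ i $ p i = B $ i $ p i" by (rule AB)
    qed
    then show ?thesis using True B1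
      by (simp add: prod.remove[of UNIV k])
  next
    case False
    then show ?thesis using A[of "p k"] B[of "p k"]
      by (simp add: prod.remove[of UNIV k])
  qed
qed

lemma axis_inner [simp]: "axis i (1::real) \<bullet> x = x $ i" "x \<bullet> axis i 1 = x $ i"
  by (simp_all add: inner_axis inner_axis')

text \<open>
  Since the dimension is a type, \<open>SO(k)\<close> is represented inside \<open>SO(N)\<close> as \<open>fixing_coset J 1\<close> with
  \<open>card J = k\<close>, and the determinant of the \<open>J\<close>-block of \<open>I - A\<close> by the full-size determinant \<open>char_det J A\<close>.
  For \<open>w = 0\<close> division by zero makes \<open>reflection w\<close> the identity.
\<close>
definition fixing_coset :: "'d set \<Rightarrow> real \<Rightarrow> (real ^ 'd ^ 'd) set" where
  "fixing_coset J s = {A. orthogonal_matrix A \<and> (\<forall>i. i \<notin> J \<longrightarrow> A *v axis i 1 = axis i 1) \<and> det A = s}"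

definition coord_proj :: "'d set \<Rightarrow> real ^ 'd \<Rightarrow> real ^ 'd" where
  "coord_proj J x = (\<chi> i. if i \<in> J then x $ i else 0)"

definition reflection :: "real ^ 'd \<Rightarrow> real ^ 'd ^ 'd" where
  "reflection w = (\<chi> i j. (if i = j then 1 else 0) - 2 * w $ i * w $ j / (w \<bullet> w))"

text \<open>This reflection exchanges \<open>x\<close> and \<open>norm x *\<^sub>R axis k 1\<close>.
  If the two coincide it is the identity, of determinant 1 instead of -1; later lemmas exclude this
  by a nonzero coordinate of \<open>x\<close> other than the \<open>k\<close>-th.\<close>

definition householder :: "'d \<Rightarrow> real ^ 'd \<Rightarrow> real ^ 'd ^ 'd" where
  "householder k x = reflection (norm x *\<^sub>R axis k 1 - x)"

definition char_det :: "'d set \<Rightarrow> real ^ 'd ^ 'd \<Rightarrow> real" where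
  "char_det J A = det (\<chi> i j. if j \<in> J then (mat 1 - A) $ i $ j else mat 1 $ i $ j)"

lemma char_det_UNIV: "char_det UNIV A = det (mat 1 - A)"
  unfolding char_det_def by (rule arg_cong[where f=det]) (simp add: vec_eq_iff)

lemma reflection_apply: "reflection w *v y = y - (2 * (w \<bullet> y) / (w \<bullet> w)) *\<^sub>R w"
proof -
  have "(\<Sum>j\<in>UNIV. ((if i = j then 1 else 0) - 2 * w $ i * w $ j / (w \<bullet> w)) * y $ j)
      = y $ i - (2 * (w \<bullet> y) / (w \<bullet> w)) * w $ i" for i
  proof -
    have "((if i = j then 1 else 0) - 2 * w $ i * w $ j / (w \<bullet> w)) * y $ j
      = (if i = j then y $ j else 0) - (2 * w $ i / (w \<bullet> w)) * (w $ j * y $ j)" for j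
      by (simp add: algebra_simps)
    then show ?thesis
      by (simp add: sum_subtractf sum_divide_distrib[symmetric] sum_distrib_left[symmetric] inner_vec_def[of w y])
  qed
  then show ?thesis
    by (simp add: reflection_def matrix_vector_mult_def vec_eq_iff)
qed

lemma transpose_reflection: "transpose (reflection w) = reflection w"
  by (simp add: reflection_def transpose_def vec_eq_iff)

lemma reflection_involution: "reflection w *v (reflection w *v y) = y"
  by (cases "w = 0") (simp_all add: reflection_apply inner_diff_right field_simps)

lemma reflection_square: "reflection w ** reflection w = mat 1"
  by (subst matrix_eq) (simp add: matrix_vector_mul_assoc[symmetric] reflection_involution)

lemma orthogonal_reflection: "orthogonal_matrix (reflection w)"
  by (simp add: orthogonal_matrix transpose_reflection reflection_square)

lemma orthogonal_inner:
  fixes A :: "real ^ 'd ^ 'd"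
  assumes "orthogonal_matrix A" shows "(A *v x) \<bullet> (A *v y) = x \<bullet> y"
  using assms orthogonal_transformation_matrix[of "(*v) A"]
  by (simp add: orthogonal_transformation_def)

lemma orthogonal_norm:
  fixes A :: "real ^ 'd ^ 'd"
  assumes "orthogonal_matrix A" shows "norm (A *v x) = norm x"
  using orthogonal_inner[OF assms] by (simp add: norm_eq_sqrt_inner)

lemma reflection_conj:
  assumes "orthogonal_matrix Q"
  shows "reflection (Q *v w) = Q ** reflection w ** transpose Q"
proof -
  have "reflection (Q *v w) *v (Q *v y) = Q *v (reflection w *v y)" for y
    by (simp add: reflection_apply orthogonal_inner[OF assms] matrix_vector_mult_diff_distrib
      matrix_vector_mult_scaleR)
  then have "reflection (Q *v w) ** Q = Q ** reflection w"
    by (subst matrix_eq) (simp add: matrix_vector_mul_assoc[symmetric])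
  then have "reflection (Q *v w) ** Q ** transpose Q= Q ** reflection w ** transpose Q" by simp
  then show ?thesis using assms
    by (simp add: matrix_mul_assoc[symmetric] orthogonal_matrix_def)
qed

lemma det_reflection_axis:
  fixes k :: "'d :: finite"
  assumes "c \<noteq> 0" shows "det (reflection (c *\<^sub>R axis k 1)) = -1"
proof -
  have "det (reflection (c *\<^sub>R axis k 1)) = reflection (c *\<^sub>R axis k 1) $ k $ k * det (mat 1 :: real^'d^'d)"
    by (rule det_row_isolated) (auto simp: reflection_def mat_def axis_def)
  moreover have "reflection (c *\<^sub>R axis k 1) $ k $ k = -1"
    using assms by (simp add: reflection_def)
  ultimately show ?thesis by simp
qed

text \<open>An orthogonal matrix carries a coordinate axis to the direction of \<open>w\<close>, so
  the reflection is conjugate to one in an axis, where a single diagonal entry differs from the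
  identity.\<close>

lemma det_reflection:
  fixes w :: "real ^ 'd"
  assumes "w \<noteq> 0" shows "det (reflection w) = -1"
proof -
  fix k :: 'd
  obtain Q where Q: "orthogonal_matrix Q" "Q *v axis k 1 = (1 / norm w) *\<^sub>R w"
    using orthogonal_matrix_exists_basis[of "(1 / norm w) *\<^sub>R w" k] assms by auto
  have "w = Q *v (norm w *\<^sub>R axis k 1)"
    using Q(2) assms by (simp add: matrix_vector_mult_scaleR)
  then have "det (reflection w) = det Q * det Q * det (reflection (norm w *\<^sub>R axis k 1))"
    using reflection_conj[OF Q(1)] by (metis det_mul det_transpose mult.commute mult.left_commute)
  then show ?thesis using det_orthogonal_matrix[OF Q(1)] assms by (auto simp: det_reflection_axis)
qed

section \<open>Orthogonal matrices fixing the coordinate vectors outside a set\<close>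

lemma coord_proj_nth [simp]: "coord_proj J x $ i = (if i \<in> J then x $ i else 0)"
  by (simp add: coord_proj_def)

text \<open>A coordinate is an inner product with an axis, and \<open>A\<close> preserves inner
  products while fixing that axis. Thus prescribing columns of \<open>A\<close> prescribes the
  corresponding rows as well.\<close>

lemma fixing_coset_nth:
  assumes "A \<in> fixing_coset J s" "i \<notin> J" shows "(A *v x) $ i = x $ i"
proof -
  have "(A *v x) \<bullet> (A *v axis i 1) = x \<bullet> axis i 1"
    using assms by (intro orthogonal_inner) (simp add: fixing_coset_def)
  then show ?thesis using assms by (simp add: fixing_coset_def)
qed

lemma fixing_coset_transpose:
  assumes "A \<in> fixing_coset J s" shows "transpose A \<in> fixing_coset J s"
proof -
  have "transpose A *v (A *v axis i 1) = axis i 1" for i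
    using assms by (simp add: fixing_coset_def matrix_vector_mul_assoc orthogonal_matrix_def)
  then have "transpose A *v axis i 1 = axis i 1" if "i \<notin> J" for i
    using assms that unfolding fixing_coset_def by (metis (mono_tags, lifting) mem_Collect_eq)
  then show ?thesis using assms
    by (simp add: fixing_coset_def orthogonal_matrix_transpose det_transpose)
qed

lemma fixing_coset_mul:
  assumes "A \<in> fixing_coset J s" "B \<in> fixing_coset J t" shows "A ** B \<in> fixing_coset J (s * t)"
  using assms by (auto simp: fixing_coset_def orthogonal_matrix_mul det_mul matrix_vector_mul_assoc[symmetric])

lemma fixing_coset_mono: "J \<subseteq> K \<Longrightarrow> fixing_coset J s \<subseteq> fixing_coset K s"
  by (auto simp: fixing_coset_def)

lemma fixing_coset_UNIV: "fixing_coset UNIV 1 = special_orthogonal_group"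
  by (auto simp: fixing_coset_def special_orthogonal_group_def rotation_matrix_def)

text \<open>The part of \<open>x\<close> outside \<open>J\<close> is a combination of fixed axes,
  and the image of the part inside \<open>J\<close> still vanishes outside \<open>J\<close>. Hence
  rotating a Gaussian vector rotates its projection in the same way.\<close>

lemma fixing_coset_coord_proj:
  assumes "A \<in> fixing_coset J s" shows "coord_proj J (A *v x) = A *v coord_proj J x"
proof -
  have y: "(\<Sum>i\<in>-J. x $ i *\<^sub>R axis i 1) = x - coord_proj J x"
    by (auto simp: vec_eq_iff axis_def if_distrib[of "\<lambda>t. _ * t"] sum.If_cases cong: if_cong)
  have "A *v (x - coord_proj J x) = x - coord_proj J x"
    unfolding y[symmetric] using assms
    by (auto simp: linear_sum[OF matrix_vector_mul_linear] matrix_vector_mult_scaleR fixing_coset_def intro!: sum.cong)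
  then have "A *v x = A *v coord_proj J x + (x - coord_proj J x)"
    by (simp add: matrix_vector_mult_diff_distrib algebra_simps)
  moreover have "(A *v coord_proj J x) $ i = 0" if "i \<notin> J" for i
    using fixing_coset_nth[OF assms that] that by simp
  ultimately show ?thesis by (auto simp: vec_eq_iff)
qed

section \<open>Householder reflections\<close>

lemma householder_axis:
  assumes "x \<noteq> 0" shows "householder k x *v axis k 1 = (1 / norm x) *\<^sub>R x"
proof (cases "norm x *\<^sub>R axis k 1 = x")
  case True
  then have "householder k x *v axis k 1 = axis k 1"
    by (simp add: householder_def reflection_apply)
  also have "\<dots> = (1 / norm x) *\<^sub>R (norm x *\<^sub>R axis k 1)" using assms by simp
  finally show ?thesis using True by simp
next
  case False
  let ?w = "norm x *\<^sub>R axis k 1 - x"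
  have wk: "?w \<bullet> axis k 1 = norm x - x $ k" by (simp)
  have ww: "?w \<bullet> ?w = 2 * norm x * (norm x - x $ k)"
    using dot_square_norm[of x] by (simp add: inner_diff_left inner_diff_right algebra_simps power2_eq_square del: dot_square_norm)
  moreover have "?w \<bullet> ?w \<noteq> 0" using False by simp
  \<comment> \<open>The factor \<open>norm x - x $ k\<close> is common to numerator and denominator,
    and it is nonzero because \<open>?w \<bullet> ?w\<close> is.\<close>
  ultimately have "2 * (?w \<bullet> axis k 1) / (?w \<bullet> ?w) = 1 / norm x"
    using assms unfolding wk by (simp add: divide_simps)
  then show ?thesis using assms
    unfolding householder_def reflection_apply by (simp add: algebra_simps)
qed

text \<open>The coordinate \<open>j\<close> prevents \<open>x\<close> from being a multiple of
  \<open>axis k 1\<close>, so the reflection is genuine and has determinant -1. Axes outside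
  \<open>J\<close> are orthogonal to the reflecting vector.\<close>

lemma householder_in_fixing_coset:
  assumes "k \<in> J" "\<And>i. i \<notin> J \<Longrightarrow> x $ i = 0" "j \<noteq> k" "x $ j \<noteq> 0"
  shows "householder k x \<in> fixing_coset J (-1)"
proof -
  let ?w = "norm x *\<^sub>R axis k 1 - x"
  have "?w $ j \<noteq> 0" using assms by (simp add: axis_def)
  then have "?w \<noteq> 0" by (metis zero_index)
  moreover have "?w $ i = 0" if "i \<notin> J" for i using assms that by (auto simp: axis_def)
  ultimately show ?thesis unfolding fixing_coset_def householder_def
    by (simp add: orthogonal_reflection det_reflection reflection_apply)
qed

text \<open>The product carries \<open>axis k 1\<close> to the direction of \<open>x\<close>, then
  to the direction of \<open>h *v x\<close>, and back to \<open>axis k 1\<close>. The two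
  determinants -1 cancel, so it lies in the smaller rotation group.\<close>

lemma householder_transport:
  assumes h: "h \<in> fixing_coset (insert k J) 1" and x: "\<And>i. i \<notin> insert k J \<Longrightarrow> x $ i = 0"
   and j: "j \<noteq> k" "x $ j \<noteq> 0" and j': "j' \<noteq> k" "(h *v x) $ j' \<noteq> 0"
  shows "householder k (h *v x) ** h ** householder k x \<in> fixing_coset J 1" (is "?A \<in> _")
proof -
  have hx: "(h *v x) $ i = 0" if "i \<notin> insert k J" for i
    using fixing_coset_nth[OF h that] x[OF that] by simp
  have 1: "householder k x \<in> fixing_coset (insert k J) (-1)"
    using x j by (intro householder_in_fixing_coset[of k _ x j]) auto
  have 2: "householder k (h *v x) \<in> fixing_coset (insert k J) (-1)"
    using hx j' by (intro householder_in_fixing_coset[of k _ "h *v x" j']) auto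
  have A: "?A \<in> fixing_coset (insert k J) 1"
    using fixing_coset_mul[OF fixing_coset_mul[OF 2 h] 1] by simp
  have ho: "orthogonal_matrix h" using h by (simp add: fixing_coset_def)
  have "x \<noteq> 0" "h *v x \<noteq> 0" using j j' by auto
  then have "?A *v axis k 1 = householder k (h *v x) *v (householder k (h *v x) *v axis k 1)"
    by (simp add: matrix_vector_mul_assoc[symmetric] householder_axis matrix_vector_mult_scaleR orthogonal_norm[OF ho])
  also have "\<dots> = axis k 1"
    unfolding householder_def by (rule reflection_involution)
  finally show ?thesis using A by (auto simp: fixing_coset_def)
qed

section \<open>The determinant recursion and its one-dimensional base case\<close>

lemma det_add_multiples_of_column:
  fixes B :: "real ^ 'd ^ 'd"
  shows "det (\<chi> i j. if j = k then B $ i $ k else B $ i $ j + c j * B $ i $ k) = det B"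
proof -
  let ?E = "\<chi> i j. if i = j then 1 else if i = k then c j else 0"
  have "(\<chi> i j. if j = k then B $ i $ k else B $ i $ j + c j * B $ i $ k) = B ** ?E"
  proof -
    have "(\<Sum>l\<in>UNIV. B $ i $ l * (if l = j then 1 else if l = k then c j else 0))
        = (if j = k then B $ i $ k else B $ i $ j + c j * B $ i $ k)" for i j
    proof -
      have "B $ i $ l * (if l = j then 1 else if l = k then c j else 0)
        = (if l = j then B $ i $ j else 0) + (if l = k then if j = k then 0 else c j * B $ i $ k else 0)" for l
        by auto
      then show ?thesis by (simp add: sum.distrib)
    qed
    then show ?thesis by (simp add: matrix_matrix_mult_def vec_eq_iff)
  qed
  \<comment> \<open>\<open>?E\<close> differs from the identity only in row \<open>k\<close>; after
    transposition the extra entries lie in column \<open>k\<close>, so row \<open>k\<close> is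
    isolated.\<close>
  moreover have "det (transpose ?E) = transpose ?E $ k $ k * det (mat 1 :: real^'d^'d)"
    by (rule det_row_isolated) (auto simp: mat_def transpose_def)
  ultimately show ?thesis
    using det_transpose[of ?E] by (simp add: det_mul) (simp add: transpose_def)
qed

lemma column_matrix: "(A :: real ^ 'n ^ 'm) $ i $ j = (A *v axis j 1) $ i"
  by (simp add: matrix_vector_mult_basis column_def)

text \<open>As \<open>W\<close> fixes \<open>axis k 1\<close>, column \<open>k\<close> of
  \<open>I - R W\<close> is the vector \<open>u\<close>, a multiple of the reflecting vector. In the
  columns of \<open>J\<close> the reflection contributes only multiples of \<open>u\<close>, which
  column operations remove. Since \<open>W\<close> preserves the \<open>k\<close>-th coordinate, row
  \<open>k\<close> of the result has a single nonzero entry at most, the diagonal one.\<close>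

lemma char_det_householder:
  fixes k :: "'d :: finite"
  assumes W: "W \<in> fixing_coset J s" and k: "k \<notin> J" and x: "x \<noteq> 0" "\<And>i. i \<notin> insert k J \<Longrightarrow> x $ i = 0"
  shows "char_det (insert k J) (householder k x ** W) = (1 - x $ k / norm x) * char_det J W"
proof -
  let ?w = "norm x *\<^sub>R axis k 1 - x"
  define u where "u = axis k 1 - (1 / norm x) *\<^sub>R x"
  have wu: "?w = norm x *\<^sub>R u" using x by (simp add: u_def algebra_simps)
  have Wk: "W *v axis k 1 = axis k 1" using W k by (simp add: fixing_coset_def)
  \<comment> \<open>The multiple of \<open>u\<close> that the reflection subtracts from column
    \<open>j\<close> of \<open>W\<close>; the factor \<open>norm x\<close> converts the reflecting
    vector into \<open>u\<close>. Columns outside \<open>insert k J\<close> are identity columns and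
    need no correction.\<close>
  define c where "c j = (if j \<in> J then 2 * (?w \<bullet> (W *v axis j 1)) / (?w \<bullet> ?w) * norm x else 0)" for j
  define B :: "real^'d^'d" where
    "B = (\<chi> i j. if j = k then u $ i else if j \<in> J then (mat 1 - W) $ i $ j else mat 1 $ i $ j)"
  have "char_det (insert k J) (householder k x ** W)
      = det (\<chi> i j. if j = k then B $ i $ k else B $ i $ j + c j * B $ i $ k)"
  proof -
    have 1: "(householder k x ** W) $ i $ k = axis k 1 $ i - u $ i" for i
      using householder_axis[OF x(1), of k] Wk
      by (simp add: column_matrix[of "_ ** _"] matrix_vector_mul_assoc[symmetric] u_def)
    have 2: "(householder k x ** W) $ i $ j = W $ i $ j - c j * u $ i" if "j \<in> J" for i j
    proof -
      have "(householder k x ** W) *v axis j 1 = W *v axis j 1 - (2 * (?w \<bullet> (W *v axis j 1)) / (?w \<bullet> ?w)) *\<^sub>R ?w"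
        by (simp only: matrix_vector_mul_assoc[symmetric] householder_def reflection_apply)
      also have "\<dots> = W *v axis j 1 - c j *\<^sub>R u"
        using that by (subst (3) wu) (simp add: c_def)
      finally show ?thesis by (simp add: column_matrix[of "_ ** _"] column_matrix[of W])
    qed
    show ?thesis unfolding char_det_def
      by (rule arg_cong[where f=det]) (use k in \<open>auto simp: vec_eq_iff 1 2 B_def mat_def axis_def c_def\<close>)
  qed
  also have "\<dots> = det B" by (rule det_add_multiples_of_column)
  also have "\<dots> = B $ k $ k * char_det J W"
    unfolding char_det_def
  proof (rule det_row_isolated)
    have Wkj: "W $ k $ j = (if j = k then 1 else 0)" for j
      using fixing_coset_nth[OF W k, of "axis j 1"] by (auto simp: column_matrix[of W] axis_def)
    then show "j \<noteq> k \<Longrightarrow> B $ k $ j = 0" for j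
      by (auto simp: B_def mat_def)
    show "j \<noteq> k \<Longrightarrow> (\<chi> i j. if j \<in> J then (mat 1 - W) $ i $ j else mat 1 $ i $ j) $ k $ j = 0" for j
      by (auto simp: mat_def Wkj)
  qed (use k in \<open>auto simp: B_def mat_def\<close>)
  also have "B $ k $ k = 1 - x $ k / norm x" by (simp add: B_def u_def axis_def)
  finally show ?thesis .
qed

text \<open>Rows and columns other than the \<open>k\<close>-th are those of the identity, so only
  one diagonal entry is free and the determinant makes it 1. Invariance under this trivial group is
  automatic, which starts the induction.\<close>

lemma fixing_coset_singleton: "fixing_coset {k} 1 = {mat 1 :: real^'d^'d}"
proof -
  have "A = mat 1" if A: "A \<in> fixing_coset {k} 1" for A :: "real^'d^'d"
  proof -
    have nth: "A $ i $ j = mat 1 $ i $ j" if "i \<noteq> k" for i j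
      using fixing_coset_nth[OF A, of i "axis j 1"] that by (auto simp: column_matrix[of A] axis_def mat_def)
    have nth': "A $ i $ j = mat 1 $ i $ j" if "j \<noteq> k" for i j
      using A that by (auto simp: column_matrix[of A] axis_def mat_def fixing_coset_def)
    have "det A = A $ k $ k * det (mat 1 :: real^'d^'d)"
      by (rule det_row_isolated) (auto simp: nth nth', auto simp: mat_def)
    then have "A $ k $ k = 1" using A by (simp add: fixing_coset_def)
    then have "A $ i $ j = mat 1 $ i $ j" for i j
      using nth[of i j] nth'[of j i] by (cases "i = k"; cases "j = k") (auto simp: mat_def)
    then show ?thesis by (simp add: vec_eq_iff)
  qed
  moreover have "mat 1 \<in> fixing_coset {k} 1"
    by (simp add: fixing_coset_def orthogonal_matrix_id)
  ultimately show ?thesis by blast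
qed

lemma reflection_axis_in_fixing_coset: "reflection (axis k 1) \<in> fixing_coset {k} (-1)"
  using det_reflection_axis[of 1 k]
  by (auto simp: fixing_coset_def orthogonal_reflection reflection_apply) (simp add: axis_def)

text \<open>This is the source of the leading factor 2 in the law: the initial reflection is -1 on
  its line, so its block of \<open>I - A\<close> is the number 2.\<close>

lemma char_det_reflection_axis:
  fixes k :: "'d :: finite"
  shows "char_det {k} (reflection (axis k 1)) = 2"
proof -
  have "char_det {k} (reflection (axis k 1)) =
    (\<chi> i j. if j \<in> {k} then (mat 1 - reflection (axis k 1)) $ i $ j else mat 1 $ i $ j) $ k $ k * det (mat 1 :: real^'d^'d)"
    unfolding char_det_def by (rule det_row_isolated) (auto simp: mat_def)
  also have "\<dots> = 2" unfolding det_I by (simp add: reflection_def mat_def)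
  finally show ?thesis .
qed

section \<open>Standard Gaussian vectors\<close>

lemma borel_measurable_vec_nth [measurable (raw)]:
  fixes f :: "'a \<Rightarrow> ('b :: euclidean_space) ^ 'n"
  assumes "f \<in> borel_measurable M" shows "(\<lambda>x. f x $ i) \<in> borel_measurable M"
  using assms by (rule measurable_compose) (intro borel_measurable_continuous_onI continuous_intros)

lemma borel_measurable_vec_lambda [measurable (raw)]:
  fixes f :: "'a \<Rightarrow> 'n :: finite \<Rightarrow> 'b :: euclidean_space"
  assumes "\<And>i. (\<lambda>x. f x i) \<in> borel_measurable M"
  shows "(\<lambda>x. \<chi> i. f x i) \<in> borel_measurable M"
  by (rule iffD2[OF borel_measurable_euclidean_space])
    (auto simp: Basis_vec_def inner_axis intro!: borel_measurable_inner assms)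

lemma borel_measurable_matrix_mult [measurable (raw)]:
  fixes A B :: "'a \<Rightarrow> real ^ 'n ^ 'n"
  assumes [measurable]: "A \<in> borel_measurable M" "B \<in> borel_measurable M"
  shows "(\<lambda>x. A x ** B x) \<in> borel_measurable M"
  unfolding matrix_matrix_mult_def by measurable

lemma borel_measurable_matrix_vector_mult [measurable (raw)]:
  fixes A :: "'a \<Rightarrow> real ^ 'n ^ 'n"
  assumes [measurable]: "A \<in> borel_measurable M" "v \<in> borel_measurable M"
  shows "(\<lambda>x. A x *v v x) \<in> borel_measurable M"
  unfolding matrix_vector_mult_def by measurable

lemma borel_measurable_transpose [measurable (raw)]:
  fixes A :: "'a \<Rightarrow> real ^ 'n ^ 'n"
  assumes [measurable]: "A \<in> borel_measurable M"
  shows "(\<lambda>x. transpose (A x)) \<in> borel_measurable M"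
  unfolding transpose_def by measurable

lemma borel_measurable_det [measurable (raw)]:
  fixes A :: "'a \<Rightarrow> real ^ 'n ^ 'n"
  assumes [measurable]: "A \<in> borel_measurable M"
  shows "(\<lambda>x. det (A x)) \<in> borel_measurable M"
  unfolding det_def by measurable

lemma borel_measurable_coord_proj [measurable (raw)]:
  assumes [measurable]: "f \<in> borel_measurable M"
  shows "(\<lambda>x. coord_proj J (f x)) \<in> borel_measurable M"
  unfolding coord_proj_def by measurable

lemma borel_measurable_householder [measurable (raw)]:
  assumes [measurable]: "f \<in> borel_measurable M"
  shows "(\<lambda>x. householder k (f x)) \<in> borel_measurable M"
  unfolding householder_def reflection_def by measurable

lemma borel_measurable_char_det [measurable (raw)]:
  assumes [measurable]: "f \<in> borel_measurable M"
  shows "(\<lambda>x. char_det J (f x)) \<in> borel_measurable M"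
  unfolding char_det_def by measurable

section \<open>The standard Gaussian measure and its density\<close>

abbreviation std_normal :: "real measure" where
  "std_normal \<equiv> density lborel (\<lambda>x. ennreal (std_normal_density x))"

lemma prob_space_std_normal: "prob_space std_normal"
  by (rule prob_space_normal_density) simp

text \<open>The description as an image of a product measure gives access to independent
  coordinates; the density with respect to \<open>lborel\<close>, which shows the rotation
  invariance, is derived from it.\<close>

definition gauss :: "(real ^ 'd) measure" where
  "gauss = distr (\<Pi>\<^sub>M i\<in>UNIV. std_normal) borel (\<lambda>f. \<chi> i. f i)"

lemma product_prob_space_std_normal: "product_prob_space (\<lambda>_. std_normal)"
  using prob_space_std_normal by (intro product_prob_spaceI)

lemma measurable_vec_lambda_PiM [measurable]:
  "(\<lambda>f. \<chi> i. f i) \<in> (\<Pi>\<^sub>M i\<in>UNIV. std_normal) \<rightarrow>\<^sub>M (borel :: (real ^ 'd) measure)"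
  "(\<lambda>f. \<chi> i. f i) \<in> (\<Pi>\<^sub>M i\<in>UNIV. lborel) \<rightarrow>\<^sub>M (borel :: (real ^ 'd) measure)"
  by (rule borel_measurable_vec_lambda; measurable)+

lemma prob_space_gauss: "prob_space gauss"
proof -
  interpret P: prob_space "\<Pi>\<^sub>M i\<in>(UNIV::'a set). std_normal"
    by (rule prob_space_PiM) (rule prob_space_std_normal)
  show ?thesis unfolding gauss_def by (rule P.prob_space_distr) measurable
qed

lemma sets_gauss [measurable_cong, simp]: "sets gauss = sets borel"
  by (simp add: gauss_def)

lemma space_gauss [simp]: "space gauss = UNIV"
  by (simp add: gauss_def)

text \<open>Lebesgue measure is determined by the volumes of boxes, and the preimage of a box is a
  product of intervals. The product over coordinates is finally reindexed by
  \<open>Basis\<close>.\<close>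

lemma lborel_vec_eq: "(lborel :: (real ^ 'd) measure) = distr (\<Pi>\<^sub>M i\<in>UNIV. lborel) borel (\<lambda>f. \<chi> i. f i)"
proof (rule lborel_eqI)
  interpret product_sigma_finite "\<lambda>_::'d. lborel :: real measure" ..
  fix l u :: "real ^ 'd" assume le: "\<And>b. b \<in> Basis \<Longrightarrow> l \<bullet> b \<le> u \<bullet> b"
  have le': "l $ i \<le> u $ i" for i
  proof -
    have "axis i (1::real) \<in> Basis" by (simp add: axis_in_Basis_iff)
    then show ?thesis using le by fastforce
  qed
  have "(\<lambda>f. \<chi> i. f i) -` box l u \<inter> space (\<Pi>\<^sub>M i\<in>UNIV. lborel) = (\<Pi>\<^sub>E i\<in>UNIV. {l $ i <..< u $ i})"
    by (rule set_eqI) (simp add: mem_box_cart space_PiM PiE_iff)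
  then have "emeasure (distr (\<Pi>\<^sub>M i\<in>UNIV. lborel) borel (\<lambda>f. \<chi> i. f i)) (box l u)
    = emeasure (\<Pi>\<^sub>M i\<in>UNIV. lborel) (\<Pi>\<^sub>E i\<in>UNIV. {l $ i <..< u $ i})"
    by (subst emeasure_distr[OF measurable_vec_lambda_PiM(2)]) (simp_all only: borel_open open_box)
  also have "\<dots> = (\<Prod>i\<in>UNIV. ennreal (u $ i - l $ i))"
    by (subst emeasure_PiM) (simp_all add: le')
  also have "\<dots> = ennreal (\<Prod>i\<in>UNIV. (u - l) $ i)"
    by (simp add: prod_ennreal le')
  also have "(\<Prod>i\<in>UNIV. (u - l) $ i) = (\<Prod>b\<in>Basis. (u - l) \<bullet> b)"
  proof -
    have B: "(Basis :: (real^'d) set) = (\<lambda>i. axis i 1) ` UNIV" by (auto simp: Basis_vec_def)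
    have "inj (\<lambda>i::'d. axis i (1::real))" by (auto simp: inj_on_def axis_eq_axis)
    then show ?thesis unfolding B by (subst prod.reindex) (simp_all add: comp_def)
  qed
  finally show "emeasure (distr (\<Pi>\<^sub>M i\<in>UNIV. lborel) borel (\<lambda>f. \<chi> i. f i)) (box l u)
     = (\<Prod>b\<in>Basis. (u - l) \<bullet> b)" .
qed simp

definition gauss_density :: "real ^ 'd \<Rightarrow> real" where
  "gauss_density x = (\<Prod>i\<in>UNIV. std_normal_density (x $ i))"

lemma borel_measurable_gauss_density [measurable]: "gauss_density \<in> borel_measurable borel"
  unfolding gauss_density_def by measurable

text \<open>Dependence on the norm alone is what makes the Gaussian measure invariant under
  orthogonal maps.\<close>

lemma gauss_density_norm:
  fixes x :: "real ^ 'd"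
  shows "gauss_density x = (1 / sqrt (2 * pi)) ^ CARD('d) * exp (- (norm x)\<^sup>2 / 2)"
proof -
  have "(norm x)\<^sup>2 = (\<Sum>i\<in>UNIV. (x $ i)\<^sup>2)"
    unfolding power2_norm_eq_inner by (simp add: inner_vec_def power2_eq_square)
  then have "- (norm x)\<^sup>2 / 2 = (\<Sum>i\<in>UNIV. - (x $ i)\<^sup>2 / 2)"
    by (simp add: sum_divide_distrib sum_negf)
  then show ?thesis
    by (simp add: gauss_density_def std_normal_density_def prod.distrib exp_sum prod_dividef power_one_over)
qed

text \<open>On rectangles the integral of the product density factorises, which identifies the
  product measure; its density is then carried to vectors by the image map.\<close>

lemma gauss_eq_density: "gauss = density lborel (\<lambda>x :: real ^ 'd. ennreal (gauss_density x))"
proof -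
  interpret L: product_sigma_finite "\<lambda>_::'d. lborel :: real measure" ..
  interpret N: product_prob_space "\<lambda>_::'d. std_normal" by (rule product_prob_space_std_normal)
  let ?D = "\<lambda>f :: 'd \<Rightarrow> real. \<Prod>i\<in>UNIV. ennreal (std_normal_density (f i))"
  have "density (\<Pi>\<^sub>M i\<in>UNIV. lborel) ?D = (\<Pi>\<^sub>M i\<in>UNIV. std_normal)"
  proof (rule N.PiM_eqI)
    fix A :: "'d \<Rightarrow> real set" assume "\<And>i. i \<in> UNIV \<Longrightarrow> A i \<in> sets std_normal"
    then have A [measurable]: "A i \<in> sets borel" for i by simp
    have [measurable]: "(\<Pi>\<^sub>E i\<in>UNIV. A i) \<in> sets (\<Pi>\<^sub>M i\<in>UNIV. lborel)"
      by (rule sets_PiM_I_finite) auto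
    have "emeasure (density (\<Pi>\<^sub>M i\<in>UNIV. lborel) ?D) (\<Pi>\<^sub>E i\<in>UNIV. A i)
       = (\<integral>\<^sup>+f. ?D f * indicator (\<Pi>\<^sub>E i\<in>UNIV. A i) f \<partial>(\<Pi>\<^sub>M i\<in>UNIV. lborel))"
      by (rule emeasure_density) measurable
    also have "\<dots> = (\<integral>\<^sup>+f. (\<Prod>i\<in>UNIV. ennreal (std_normal_density (f i)) * indicator (A i) (f i)) \<partial>(\<Pi>\<^sub>M i\<in>UNIV. lborel))"
    proof (rule nn_integral_cong)
      fix f :: "'d \<Rightarrow> real"
      have "indicator (\<Pi>\<^sub>E i\<in>UNIV. A i) f = (\<Prod>i\<in>UNIV. indicator (A i) (f i) :: ennreal)"
        by (cases "f \<in> (\<Pi>\<^sub>E i\<in>UNIV. A i)") (auto simp: PiE_def Pi_def indicator_def intro!: exI)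
      then show "?D f * indicator (\<Pi>\<^sub>E i\<in>UNIV. A i) f = (\<Prod>i\<in>UNIV. ennreal (std_normal_density (f i)) * indicator (A i) (f i))"
        by (simp add: prod.distrib)
    qed
    also have "\<dots> = (\<Prod>i\<in>UNIV. \<integral>\<^sup>+x. ennreal (std_normal_density x) * indicator (A i) x \<partial>lborel)"
      by (rule L.product_nn_integral_prod) auto
    also have "\<dots> = (\<Prod>i\<in>UNIV. emeasure std_normal (A i))"
      by (intro prod.cong refl emeasure_density[symmetric]) auto
    finally show "emeasure (density (\<Pi>\<^sub>M i\<in>UNIV. lborel) ?D) (\<Pi>\<^sub>E i\<in>UNIV. A i) = (\<Prod>i\<in>UNIV. emeasure std_normal (A i))" .
  qed (auto intro!: sets_PiM_cong)
  then have "gauss = distr (density (\<Pi>\<^sub>M i\<in>UNIV. lborel) ?D) borel (\<lambda>f. \<chi> i. f i)"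
    by (simp add: gauss_def)
  also have "?D = (\<lambda>f. ennreal (gauss_density (\<chi> i. f i)))"
    by (simp add: gauss_density_def prod_ennreal)
  also have "distr (density (\<Pi>\<^sub>M i\<in>UNIV. lborel) \<dots>) borel (\<lambda>f. \<chi> i. f i)
      = density (distr (\<Pi>\<^sub>M i\<in>UNIV. lborel) borel (\<lambda>f. \<chi> i. f i)) (\<lambda>x. ennreal (gauss_density x))"
    by (rule density_distr[symmetric]) measurable
  finally show ?thesis by (simp add: lborel_vec_eq[symmetric])
qed

lemma nn_integral_gauss_density: "(\<integral>\<^sup>+x. gauss_density x \<partial>lborel) = 1"
proof -
  have "emeasure gauss (UNIV :: (real ^ 'a) set) = 1"
    using prob_space.emeasure_space_1[OF prob_space_gauss] by simp
  then show ?thesis by (simp add: gauss_eq_density emeasure_density)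
qed

section \<open>Invariance under orthogonal maps\<close>

lemma nn_integral_lborel_translate:
  fixes c :: "'a :: euclidean_space"
  assumes "f \<in> borel_measurable borel"
  shows "(\<integral>\<^sup>+x. f (c + x) \<partial>lborel) = (\<integral>\<^sup>+x. f x \<partial>lborel)"
  using nn_integral_distr[of "(+) c" lborel borel f] assms by (simp add: lborel_distr_plus)

text \<open>
  Both Lebesgue measure and its image under an orthogonal map are translation invariant, so they
  agree up to a constant; integrating the density of a Gaussian measure, which depends on the norm
  only, shows that the constant is 1.
\<close>
lemma nn_integral_lborel_orthogonal:
  fixes h :: "real ^ 'd ^ 'd"
  assumes h: "orthogonal_matrix h" and f [measurable]: "f \<in> borel_measurable borel"
  shows "(\<integral>\<^sup>+x. f (h *v x) \<partial>lborel) = (\<integral>\<^sup>+x. f x \<partial>lborel)"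
proof -
  let ?G = "\<lambda>x :: real ^ 'd. ennreal (gauss_density x)"
  have G_norm: "?G x = ?G y" if "norm x = norm y" for x y
    using that by (simp add: gauss_density_norm)
  have hh: "h *v (transpose h *v x) = x" for x
    using h by (simp only: matrix_vector_mul_assoc orthogonal_matrix_def matrix_vector_mul_lid)
  \<comment> \<open>A second variable \<open>y\<close> of total Gaussian mass 1 is inserted; it will
    take over the role of the integration variable.\<close>
  have "(\<integral>\<^sup>+x. f x \<partial>lborel) = (\<integral>\<^sup>+y. (\<integral>\<^sup>+x. f x \<partial>lborel) * ?G y \<partial>lborel)"
    by (simp add: nn_integral_cmult nn_integral_gauss_density)
  also have "\<dots> = (\<integral>\<^sup>+y. \<integral>\<^sup>+x. f x * ?G y \<partial>lborel \<partial>lborel)"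
    by (simp add: nn_integral_multc)
  also have "\<dots> = (\<integral>\<^sup>+y. \<integral>\<^sup>+x. f (h *v y + x) * ?G y \<partial>lborel \<partial>lborel)"
    by (intro nn_integral_cong nn_integral_lborel_translate[symmetric]) measurable
  also have "\<dots> = (\<integral>\<^sup>+x. \<integral>\<^sup>+y. f (h *v y + x) * ?G y \<partial>lborel \<partial>lborel)"
    by (rule lborel_pair.Fubini') measurable
  \<comment> \<open>Shifting \<open>y\<close> by \<open>- (transpose h *v x)\<close> removes
    \<open>x\<close> from the argument of \<open>f\<close>. The Gaussian factor then depends only on
    the norm of \<open>h *v y - x\<close>, so \<open>x\<close> can be integrated out.\<close>
  also have "\<dots> = (\<integral>\<^sup>+x. \<integral>\<^sup>+y. f (h *v (- (transpose h *v x) + y) + x) * ?G (- (transpose h *v x) + y) \<partial>lborel \<partial>lborel)"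
    by (intro nn_integral_cong nn_integral_lborel_translate[symmetric]) measurable
  also have "\<dots> = (\<integral>\<^sup>+x. \<integral>\<^sup>+y. f (h *v y) * ?G (- (h *v y) + x) \<partial>lborel \<partial>lborel)"
  proof (intro nn_integral_cong arg_cong2[where f="(*)"])
    fix x y
    have e: "h *v (- (transpose h *v x) + y) = h *v y - x"
    proof -
      have "- (transpose h *v x) + y = y - transpose h *v x" by simp
      then show ?thesis by (simp only: matrix_vector_mult_diff_distrib hh)
    qed
    show "f (h *v (- (transpose h *v x) + y) + x) = f (h *v y)" unfolding e by simp
    have "norm (- (transpose h *v x) + y) = norm (h *v y - x)"
      by (metis e orthogonal_norm[OF h])
    then show "?G (- (transpose h *v x) + y) = ?G (- (h *v y) + x)"
      by (intro G_norm) (simp add: norm_minus_commute)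
  qed
  also have "\<dots> = (\<integral>\<^sup>+y. \<integral>\<^sup>+x. f (h *v y) * ?G (- (h *v y) + x) \<partial>lborel \<partial>lborel)"
    by (rule lborel_pair.Fubini') measurable
  also have "\<dots> = (\<integral>\<^sup>+y. f (h *v y) \<partial>lborel)"
  proof (rule nn_integral_cong)
    fix y
    have "(\<integral>\<^sup>+x. ?G (- (h *v y) + x) \<partial>lborel) = 1"
      by (subst nn_integral_lborel_translate) (measurable, simp add: nn_integral_gauss_density)
    then show "(\<integral>\<^sup>+x. f (h *v y) * ?G (- (h *v y) + x) \<partial>lborel) = f (h *v y)"
      by (simp add: nn_integral_cmult)
  qed
  finally show ?thesis by simp
qed

lemma nn_integral_gauss_orthogonal:
  fixes h :: "real ^ 'd ^ 'd"
  assumes h: "orthogonal_matrix h" and f [measurable]: "f \<in> borel_measurable borel"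
  shows "(\<integral>\<^sup>+x. f (h *v x) \<partial>gauss) = (\<integral>\<^sup>+x. f x \<partial>gauss)"
proof -
  have "(\<integral>\<^sup>+x. f (h *v x) \<partial>gauss) = (\<integral>\<^sup>+x. gauss_density (h *v x) * f (h *v x) \<partial>lborel)"
    unfolding gauss_eq_density
    by (subst nn_integral_density) (measurable, simp add: gauss_density_norm orthogonal_norm[OF h])
  also have "\<dots> = (\<integral>\<^sup>+x. gauss_density x * f x \<partial>lborel)"
    by (rule nn_integral_lborel_orthogonal[OF h]) measurable
  also have "\<dots> = (\<integral>\<^sup>+x. f x \<partial>gauss)"
    unfolding gauss_eq_density by (subst nn_integral_density) auto
  finally show ?thesis .
qed

text \<open>A normal variable has no atom at 0. This discards the null event on which the
  Householder reflections may degenerate.\<close>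

lemma AE_gauss_nonzero: "AE x in gauss. x $ j \<noteq> (0::real)"
proof -
  have "AE x in std_normal. x \<noteq> 0"
    using AE_lborel_singleton[of "0::real"] by (auto simp: AE_density elim!: eventually_mono)
  then have "AE f in (\<Pi>\<^sub>M i\<in>UNIV. std_normal). f j \<noteq> 0"
    by (intro AE_PiM_component prob_space_std_normal) auto
  then show ?thesis unfolding gauss_def by (subst AE_distr_iff) auto
qed

text \<open>Rotation invariance transports the null set where a coordinate vanishes.\<close>

lemma AE_gauss_orthogonal:
  fixes h :: "real ^ 'd ^ 'd"
  assumes h: "orthogonal_matrix h"
  shows "AE x in gauss. (h *v x) $ j \<noteq> 0"
proof -
  have "AE x in gauss. x $ j \<noteq> 0" by (rule AE_gauss_nonzero)
  then have "(\<integral>\<^sup>+x. indicator {x. x $ j = 0} x \<partial>gauss) = 0"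
    by (subst nn_integral_0_iff_AE) auto
  then have "(\<integral>\<^sup>+x. indicator {x. x $ j = 0} (h *v x) \<partial>gauss) = 0"
    by (subst nn_integral_gauss_orthogonal[OF h]) auto
  then show ?thesis
    by (subst (asm) nn_integral_0_iff_AE) auto
qed

section \<open>The coordinate of a uniform point on the sphere\<close>

text \<open>The substitution rule applies on the intervals \<open>{0..?b n}\<close>, and monotone
  convergence exhausts the half-line. The endpoint 0 is a null set.\<close>

lemma nn_integral_square_substitution:
  fixes f :: "real \<Rightarrow> ennreal"
  assumes [measurable]: "f \<in> borel_measurable borel"
  shows "(\<integral>\<^sup>+z. f z * indicator {0<..} z \<partial>lborel)
    = (\<integral>\<^sup>+x. f (x\<^sup>2) * ennreal (2 * x) * indicator {0<..} x \<partial>lborel)"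
proof -
  \<comment> \<open>Adding 1 keeps every interval nondegenerate and makes
    \<open>(?b n)\<^sup>2\<close> at least \<open>real n\<close>.\<close>
  let ?b = "\<lambda>n::nat. real n + 1"
  have b2: "(?b m)\<^sup>2 \<le> (?b n)\<^sup>2" if "m \<le> n" for m n using that by (intro power_mono) auto
  have "(\<integral>\<^sup>+z. f z * indicator {0<..} z \<partial>lborel) = (\<integral>\<^sup>+z. (SUP n. f z * indicator {0..(?b n)\<^sup>2} z) \<partial>lborel)"
  proof (rule nn_integral_cong_AE)
    have "f z * indicator {0<..} z = (SUP n. f z * indicator {0..(?b n)\<^sup>2} z)" if z: "z \<noteq> 0" for z
    proof (cases "0 < z")
      case True
      obtain n where "z \<le> real n" using real_arch_simple by blast
      also have "\<dots> \<le> (?b n)\<^sup>2" by (simp add: power2_eq_square algebra_simps)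
      finally have "f z * indicator {0<..} z = f z * indicator {0..(?b n)\<^sup>2} z" using True by simp
      also have "\<dots> \<le> (SUP n. f z * indicator {0..(?b n)\<^sup>2} z)" by (rule SUP_upper) simp
      finally show ?thesis using True
        by (intro antisym SUP_least) (auto split: split_indicator)
    qed (use z in auto)
    then show "AE z in lborel. f z * indicator {0<..} z = (SUP n. f z * indicator {0..(?b n)\<^sup>2} z)"
      using AE_lborel_singleton[of "0::real"] by (auto elim!: eventually_mono)
  qed
  also have "\<dots> = (SUP n. \<integral>\<^sup>+z. f z * indicator {0..(?b n)\<^sup>2} z \<partial>lborel)"
    by (rule nn_integral_monotone_convergence_SUP)
      (auto simp: incseq_def le_fun_def split: split_indicator dest: b2)
  also have "\<dots> = (SUP n. \<integral>\<^sup>+x. f (x\<^sup>2) * ennreal (2 * x) * indicator {0..?b n} x \<partial>lborel)"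
  proof (rule SUP_cong[OF refl])
    fix n
    show "(\<integral>\<^sup>+z. f z * indicator {0..(?b n)\<^sup>2} z \<partial>lborel)
      = (\<integral>\<^sup>+x. f (x\<^sup>2) * ennreal (2 * x) * indicator {0..?b n} x \<partial>lborel)"
    proof -
      have "((\<lambda>x. x\<^sup>2) has_real_derivative 2 * x) (at x)" for x :: real
        by (auto intro!: derivative_eq_intros)
      then show ?thesis
        using nn_integral_substitution_aux[of f 0 "?b n" "\<lambda>x. x\<^sup>2" "\<lambda>x. 2 * x"]
        by (auto intro!: continuous_intros)
    qed
  qed
  also have "\<dots> = (\<integral>\<^sup>+x. (SUP n. f (x\<^sup>2) * ennreal (2 * x) * indicator {0..?b n} x) \<partial>lborel)"
    by (rule nn_integral_monotone_convergence_SUP[symmetric])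
      (auto simp: incseq_def le_fun_def split: split_indicator)
  also have "\<dots> = (\<integral>\<^sup>+x. f (x\<^sup>2) * ennreal (2 * x) * indicator {0<..} x \<partial>lborel)"
  proof (rule nn_integral_cong_AE)
    have "(SUP n. f (x\<^sup>2) * ennreal (2 * x) * indicator {0..?b n} x) = f (x\<^sup>2) * ennreal (2 * x) * indicator {0<..} x"
      if x: "x \<noteq> 0" for x
    proof (cases "0 < x")
      case True
      obtain n where "x \<le> real n" using real_arch_simple by blast
      then have "f (x\<^sup>2) * ennreal (2 * x) * indicator {0<..} x = f (x\<^sup>2) * ennreal (2 * x) * indicator {0..?b n} x"
        using True by simp
      also have "\<dots> \<le> (SUP n. f (x\<^sup>2) * ennreal (2 * x) * indicator {0..?b n} x)"
        by (rule SUP_upper) simp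
      finally show ?thesis using True
        by (intro antisym SUP_least) (auto split: split_indicator)
    qed (use x in auto)
    then show "AE x in lborel. (SUP n. f (x\<^sup>2) * ennreal (2 * x) * indicator {0..?b n} x)
      = f (x\<^sup>2) * ennreal (2 * x) * indicator {0<..} x"
      using AE_lborel_singleton[of "0::real"] by (auto elim!: eventually_mono)
  qed
  finally show ?thesis .
qed

lemma nn_integral_real_symmetrize:
  fixes f :: "real \<Rightarrow> ennreal"
  assumes [measurable]: "f \<in> borel_measurable borel"
  shows "(\<integral>\<^sup>+x. f x \<partial>lborel) = (\<integral>\<^sup>+x. (f x + f (- x)) * indicator {0<..} x \<partial>lborel)"
proof -
  have "(\<integral>\<^sup>+x. f x \<partial>lborel) = (\<integral>\<^sup>+x. f x * indicator {0<..} x + f x * indicator {..<0} x \<partial>lborel)"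
    using AE_lborel_singleton[of "0::real"]
    by (intro nn_integral_cong_AE) (auto elim!: eventually_mono split: split_indicator)
  also have "\<dots> = (\<integral>\<^sup>+x. f x * indicator {0<..} x \<partial>lborel) + (\<integral>\<^sup>+x. f x * indicator {..<0} x \<partial>lborel)"
    by (rule nn_integral_add) auto
  also have "(\<integral>\<^sup>+x. f x * indicator {..<0} x \<partial>lborel) = (\<integral>\<^sup>+x. f (- x) * indicator {0<..} x \<partial>lborel)"
    using nn_integral_real_affine[of "\<lambda>x. f x * indicator {..<0} x" "-1" 0]
    by (auto intro!: nn_integral_cong split: split_indicator)
  also have "(\<integral>\<^sup>+x. f x * indicator {0<..} x \<partial>lborel) + \<dots>
      = (\<integral>\<^sup>+x. (f x + f (- x)) * indicator {0<..} x \<partial>lborel)"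
    by (subst nn_integral_add[symmetric]) (auto simp: distrib_right)
  finally show ?thesis .
qed

section \<open>Separating the direction of a Gaussian vector from its radius\<close>

definition chi_square_weight :: "nat \<Rightarrow> real \<Rightarrow> ennreal" where
  "chi_square_weight m z = ennreal (z powr (real m / 2 - 1) * exp (- z / 2)) * indicator {0<..} z"

text \<open>Up to its constant this is the density of one coordinate of a uniform point on the unit
  sphere in dimension \<open>m + 1\<close>.\<close>

definition sphere_weight :: "nat \<Rightarrow> real \<Rightarrow> ennreal" where
  "sphere_weight m u = ennreal ((1 - u\<^sup>2) powr (real m / 2 - 1)) * indicator {-1<..<1} u"

lemma borel_measurable_weights [measurable]:
  "chi_square_weight m \<in> borel_measurable borel" "sphere_weight m \<in> borel_measurable borel"
  unfolding chi_square_weight_def sphere_weight_def by measurable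

text \<open>
  The substitutions \<open>z = x\<^sup>2 + y\<close> and \<open>x = u \<surd>z\<close> separate the direction \<open>u\<close> from the squared radius \<open>z\<close>.
\<close>
lemma nn_integral_normal_chi_square:
  fixes f :: "real \<Rightarrow> real \<Rightarrow> ennreal"
  assumes [measurable]: "case_prod f \<in> borel_measurable (borel \<Otimes>\<^sub>M borel)"
  shows "(\<integral>\<^sup>+x. \<integral>\<^sup>+y. f (x / sqrt (x\<^sup>2 + y)) (x\<^sup>2 + y) * chi_square_weight m y \<partial>lborel \<partial>std_normal)
    = ennreal (1 / sqrt (2 * pi)) *
      (\<integral>\<^sup>+z. (\<integral>\<^sup>+u. f u z * sphere_weight m u \<partial>lborel) * chi_square_weight (Suc m) z \<partial>lborel)"
proof -
  let ?K = "ennreal (1 / sqrt (2 * pi))"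
  define G where "G x z = f (x / sqrt z) z * (ennreal (std_normal_density x) * chi_square_weight m (z - x\<^sup>2))" for x z
  have [measurable]: "case_prod G \<in> borel_measurable (borel \<Otimes>\<^sub>M borel)"
    unfolding G_def by measurable
  have "(\<integral>\<^sup>+x. \<integral>\<^sup>+y. f (x / sqrt (x\<^sup>2 + y)) (x\<^sup>2 + y) * chi_square_weight m y \<partial>lborel \<partial>std_normal)
    = (\<integral>\<^sup>+x. \<integral>\<^sup>+y. G x (x\<^sup>2 + y) \<partial>lborel \<partial>lborel)"
    by (simp add: nn_integral_density nn_integral_cmult[symmetric] G_def mult_ac)
  also have "\<dots> = (\<integral>\<^sup>+x. \<integral>\<^sup>+z. G x z \<partial>lborel \<partial>lborel)"
    by (intro nn_integral_cong nn_integral_lborel_translate) measurable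
  also have "\<dots> = (\<integral>\<^sup>+z. \<integral>\<^sup>+x. G x z \<partial>lborel \<partial>lborel)"
    by (rule lborel_pair.Fubini') measurable
  also have "\<dots> = (\<integral>\<^sup>+z. ?K * ((\<integral>\<^sup>+u. f u z * sphere_weight m u \<partial>lborel) * chi_square_weight (Suc m) z) \<partial>lborel)"
  proof (rule nn_integral_cong)
    fix z :: real
    show "(\<integral>\<^sup>+x. G x z \<partial>lborel) = ?K * ((\<integral>\<^sup>+u. f u z * sphere_weight m u \<partial>lborel) * chi_square_weight (Suc m) z)"
    proof (cases "0 < z")
      case False
      then have "z - x\<^sup>2 \<le> 0" for x by (smt (verit) zero_le_power2)
      then have "chi_square_weight m (z - x\<^sup>2) = 0" for x
        by (simp add: chi_square_weight_def indicator_def not_less)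
      then have "G x z = 0" for x by (simp add: G_def)
      then show ?thesis using False by (simp add: chi_square_weight_def)
    next
      case True
      \<comment> \<open>Here \<open>sqrt z\<close> is the Jacobian of \<open>x = sqrt z * u\<close>.
        The exponentials merge into \<open>exp (- z / 2)\<close>, and the Jacobian raises the power
        of \<open>z\<close> by one half, so the integrand splits into a function of \<open>u\<close>
        and the weight with one more degree of freedom.\<close>
      have *: "ennreal (sqrt z) * (ennreal (std_normal_density (sqrt z * u)) * chi_square_weight m (z - (sqrt z * u)\<^sup>2))
        = ?K * (sphere_weight m u * chi_square_weight (Suc m) z)" for u
      proof -
        have e: "z - (sqrt z * u)\<^sup>2 = z * (1 - u\<^sup>2)" using True by (simp add: power_mult_distrib algebra_simps)
        show ?thesis
        proof (cases "u\<^sup>2 < 1")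
          case u: True
          then have u': "- 1 < u" "u < 1" by (auto simp: abs_square_less_1 abs_less_iff)
          have "sqrt z * (std_normal_density (sqrt z * u) * ((z * (1 - u\<^sup>2)) powr (real m / 2 - 1) * exp (- (z * (1 - u\<^sup>2)) / 2)))
            = 1 / sqrt (2 * pi) * ((1 - u\<^sup>2) powr (real m / 2 - 1) * (z powr (real (Suc m) / 2 - 1) * exp (- z / 2)))"
          proof -
            have "exp (- (sqrt z * u)\<^sup>2 / 2) * exp (- (z * (1 - u\<^sup>2)) / 2) = exp (- z / 2)"
              using True by (simp add: exp_add[symmetric] power_mult_distrib field_simps)
            moreover have "sqrt z * (z * (1 - u\<^sup>2)) powr (real m / 2 - 1) = (1 - u\<^sup>2) powr (real m / 2 - 1) * z powr (real (Suc m) / 2 - 1)"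
            proof -
              have "sqrt z * z powr (real m / 2 - 1) = z powr (real (Suc m) / 2 - 1)"
                using True by (simp add: powr_half_sqrt[symmetric] powr_add[symmetric] add_divide_distrib)
              then show ?thesis using True u by (simp add: powr_mult mult_ac)
            qed
            moreover have "s * (k * a * (w * b)) = k * (p * (q * c))"
              if "a * b = c" "s * w = p * q" for s k a w b p q c :: real
            proof -
              have "s * (k * a * (w * b)) = k * ((s * w) * (a * b))" by (simp only: mult_ac)
              then show ?thesis by (simp only: that mult.assoc)
            qed
            ultimately show ?thesis
              unfolding std_normal_density_def by blast
          qed
          then show ?thesis using True u u' unfolding e chi_square_weight_def sphere_weight_def
            by (simp add: ennreal_mult'[symmetric] mult_ac)
        next
          case False
          then have "\<not> (-1 < u \<and> u < 1)" by (auto simp: abs_square_less_1 abs_less_iff)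
          moreover have "z * (1 - u\<^sup>2) \<le> 0" using False True by (simp add: mult_le_0_iff)
          ultimately show ?thesis
            unfolding e chi_square_weight_def sphere_weight_def by (auto split: split_indicator)
        qed
      qed
      have "(\<integral>\<^sup>+x. G x z \<partial>lborel) = ennreal (sqrt z) * (\<integral>\<^sup>+u. G (sqrt z * u) z \<partial>lborel)"
        using nn_integral_real_affine[of "\<lambda>x. G x z" "sqrt z" 0] True by simp
      also have "\<dots> = (\<integral>\<^sup>+u. f u z * (ennreal (sqrt z) * (ennreal (std_normal_density (sqrt z * u)) * chi_square_weight m (z - (sqrt z * u)\<^sup>2))) \<partial>lborel)"
        using True by (simp add: G_def nn_integral_cmult[symmetric] mult_ac)
      also have "\<dots> = (\<integral>\<^sup>+u. (?K * chi_square_weight (Suc m) z) * (f u z * sphere_weight m u) \<partial>lborel)"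
        unfolding * by (simp add: mult_ac)
      also have "\<dots> = (?K * chi_square_weight (Suc m) z) * (\<integral>\<^sup>+u. f u z * sphere_weight m u \<partial>lborel)"
        by (rule nn_integral_cmult) measurable
      finally show ?thesis by (simp add: mult_ac)
    qed
  qed
  also have "\<dots> = ?K * (\<integral>\<^sup>+z. (\<integral>\<^sup>+u. f u z * sphere_weight m u \<partial>lborel) * chi_square_weight (Suc m) z \<partial>lborel)"
    by (rule nn_integral_cmult) measurable
  finally show ?thesis .
qed

lemma nn_integral_normal_square:
  fixes f :: "real \<Rightarrow> ennreal"
  assumes [measurable]: "f \<in> borel_measurable borel"
  shows "(\<integral>\<^sup>+x. f (x\<^sup>2) \<partial>std_normal) = ennreal (1 / sqrt (2 * pi)) * (\<integral>\<^sup>+z. f z * chi_square_weight 1 z \<partial>lborel)"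
proof -
  let ?K = "ennreal (1 / sqrt (2 * pi))"
  have "(\<integral>\<^sup>+x. f (x\<^sup>2) \<partial>std_normal) = (\<integral>\<^sup>+x. ennreal (std_normal_density x) * f (x\<^sup>2) \<partial>lborel)"
    by (rule nn_integral_density) auto
  also have "\<dots> = (\<integral>\<^sup>+x. (2 * (ennreal (std_normal_density x) * f (x\<^sup>2))) * indicator {0<..} x \<partial>lborel)"
    by (subst nn_integral_real_symmetrize) (measurable, simp only: mult_2 std_normal_density_def power2_minus)
  also have "\<dots> = (\<integral>\<^sup>+x. (?K * (f (x\<^sup>2) * chi_square_weight 1 (x\<^sup>2))) * ennreal (2 * x) * indicator {0<..} x \<partial>lborel)"
  proof (rule nn_integral_cong)
    fix x :: real
    show "(2 * (ennreal (std_normal_density x) * f (x\<^sup>2))) * indicator {0<..} x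
        = (?K * (f (x\<^sup>2) * chi_square_weight 1 (x\<^sup>2))) * ennreal (2 * x) * indicator {0<..} x"
    proof (cases "0 < x")
      case True
      have "(x\<^sup>2) powr (- 1 / 2) = 1 / x"
        using True by (simp add: powr_minus_divide powr_half_sqrt)
      \<comment> \<open>The factor 2 on the left counts both signs of \<open>x\<close>. On the right
        the power -1/2 of \<open>x\<^sup>2\<close> cancels the \<open>x\<close> of the Jacobian
        \<open>2 * x\<close>.\<close>
      then have "2 * std_normal_density x = 1 / sqrt (2 * pi) * ((x\<^sup>2) powr (1 / 2 - 1) * exp (- x\<^sup>2 / 2)) * (2 * x)"
        using True by (simp add: std_normal_density_def)
      then have "ennreal 2 * ennreal (std_normal_density x) = ?K * chi_square_weight 1 (x\<^sup>2) * ennreal (2 * x)"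
        using True unfolding chi_square_weight_def by (simp add: ennreal_mult[symmetric] del: ennreal_numeral)
      then have "f (x\<^sup>2) * (ennreal 2 * ennreal (std_normal_density x)) = f (x\<^sup>2) * (?K * chi_square_weight 1 (x\<^sup>2) * ennreal (2 * x))"
        by (rule arg_cong)
      then show ?thesis using True by (simp only: mult_ac ennreal_numeral)
    qed simp
  qed
  also have "\<dots> = (\<integral>\<^sup>+z. ?K * (f z * chi_square_weight 1 z) * indicator {0<..} z \<partial>lborel)"
    by (rule nn_integral_square_substitution[symmetric]) measurable
  also have "\<dots> = (\<integral>\<^sup>+z. ?K * (f z * chi_square_weight 1 z) \<partial>lborel)"
    by (intro nn_integral_cong) (auto simp: chi_square_weight_def split: split_indicator)
  also have "\<dots> = ?K * (\<integral>\<^sup>+z. f z * chi_square_weight 1 z \<partial>lborel)"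
    by (rule nn_integral_cmult) measurable
  finally show ?thesis .
qed

text \<open>A sum of squares has a chi-square law. A new coordinate is absorbed by
  \<open>nn_integral_normal_chi_square\<close> for a function of \<open>z\<close> alone, the
  integral over \<open>u\<close> going into the constant. The constant has to precede the quantifier
  over \<open>f\<close>, so that total mass can later determine it.\<close>

lemma nn_integral_sum_squares_normal:
  assumes "finite J" "J \<noteq> {}"
  shows "\<exists>c. \<forall>f \<in> borel_measurable borel.
    (\<integral>\<^sup>+x. f (\<Sum>i\<in>J. (x i)\<^sup>2) \<partial>(\<Pi>\<^sub>M i\<in>J. std_normal)) = c * (\<integral>\<^sup>+z. f z * chi_square_weight (card J) z \<partial>lborel)"
  using assms
proof (induction rule: finite_ne_induct)
  case (singleton k)
  interpret product_prob_space "\<lambda>_::'a. std_normal" by (rule product_prob_space_std_normal)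
  have "(\<integral>\<^sup>+x. f (\<Sum>i\<in>{k}. (x i)\<^sup>2) \<partial>(\<Pi>\<^sub>M i\<in>{k}. std_normal)) = ennreal (1 / sqrt (2 * pi)) * (\<integral>\<^sup>+z. f z * chi_square_weight (card {k}) z \<partial>lborel)"
    if [measurable]: "f \<in> borel_measurable borel" for f
    using product_nn_integral_singleton[of "\<lambda>x. f (x\<^sup>2)" k] by (simp add: nn_integral_normal_square)
  then show ?case by blast
next
  case (insert k J)
  interpret product_prob_space "\<lambda>_::'a. std_normal" by (rule product_prob_space_std_normal)
  obtain c where c: "\<And>f. f \<in> borel_measurable borel \<Longrightarrow>
    (\<integral>\<^sup>+x. f (\<Sum>i\<in>J. (x i)\<^sup>2) \<partial>(\<Pi>\<^sub>M i\<in>J. std_normal)) = c * (\<integral>\<^sup>+z. f z * chi_square_weight (card J) z \<partial>lborel)"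
    using insert.IH by blast
  have "(\<integral>\<^sup>+x. f (\<Sum>i\<in>insert k J. (x i)\<^sup>2) \<partial>(\<Pi>\<^sub>M i\<in>insert k J. std_normal))
     = c * ennreal (1 / sqrt (2 * pi)) * (\<integral>\<^sup>+u. sphere_weight (card J) u \<partial>lborel) * (\<integral>\<^sup>+z. f z * chi_square_weight (card (insert k J)) z \<partial>lborel)"
    if [measurable]: "f \<in> borel_measurable borel" for f
  proof -
    have "(\<integral>\<^sup>+x. f (\<Sum>i\<in>insert k J. (x i)\<^sup>2) \<partial>(\<Pi>\<^sub>M i\<in>insert k J. std_normal))
       = (\<integral>\<^sup>+y. \<integral>\<^sup>+x. f (\<Sum>i\<in>insert k J. ((x(k := y)) i)\<^sup>2) \<partial>(\<Pi>\<^sub>M i\<in>J. std_normal) \<partial>std_normal)"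
      using insert.hyps by (intro product_nn_integral_insert_rev) auto
    also have "\<dots> = (\<integral>\<^sup>+y. \<integral>\<^sup>+x. f (y\<^sup>2 + (\<Sum>i\<in>J. (x i)\<^sup>2)) \<partial>(\<Pi>\<^sub>M i\<in>J. std_normal) \<partial>std_normal)"
    proof (intro nn_integral_cong)
      fix x :: "'a \<Rightarrow> real" and y
      have "(\<Sum>i\<in>J. ((x(k := y)) i)\<^sup>2) = (\<Sum>i\<in>J. (x i)\<^sup>2)"
        using insert.hyps by (intro sum.cong) auto
      then show "f (\<Sum>i\<in>insert k J. ((x(k := y)) i)\<^sup>2) = f (y\<^sup>2 + (\<Sum>i\<in>J. (x i)\<^sup>2))"
        using insert.hyps by simp
    qed
    also have "\<dots> = (\<integral>\<^sup>+y. c * (\<integral>\<^sup>+z. f (y\<^sup>2 + z) * chi_square_weight (card J) z \<partial>lborel) \<partial>std_normal)"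
      by (intro nn_integral_cong c) measurable
    also have "\<dots> = c * (\<integral>\<^sup>+y. \<integral>\<^sup>+z. f (y\<^sup>2 + z) * chi_square_weight (card J) z \<partial>lborel \<partial>std_normal)"
      by (rule nn_integral_cmult) measurable
    also have "\<dots> = c * (ennreal (1 / sqrt (2 * pi)) *
        (\<integral>\<^sup>+z. (\<integral>\<^sup>+u. f z * sphere_weight (card J) u \<partial>lborel) * chi_square_weight (Suc (card J)) z \<partial>lborel))"
      by (subst nn_integral_normal_chi_square[of "\<lambda>u z. f z"]) auto
    also have "(\<integral>\<^sup>+z. (\<integral>\<^sup>+u. f z * sphere_weight (card J) u \<partial>lborel) * chi_square_weight (Suc (card J)) z \<partial>lborel)
        = (\<integral>\<^sup>+z. (\<integral>\<^sup>+u. sphere_weight (card J) u \<partial>lborel) * (f z * chi_square_weight (Suc (card J)) z) \<partial>lborel)"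
      by (simp add: nn_integral_cmult mult_ac)
    also have "\<dots> = (\<integral>\<^sup>+u. sphere_weight (card J) u \<partial>lborel) * (\<integral>\<^sup>+z. f z * chi_square_weight (Suc (card J)) z \<partial>lborel)"
      by (rule nn_integral_cmult) measurable
    finally show ?thesis using insert.hyps by (simp add: mult_ac)
  qed
  then show ?case by blast
qed

text \<open>The squares of the coordinates in \<open>J\<close> add up to a chi-square variable, so
  \<open>nn_integral_normal_chi_square\<close> applies to a function of the direction
  \<open>u\<close> alone; the radial integral becomes part of the constant.\<close>

lemma nn_integral_gauss_direction:
  fixes k :: "'d :: finite"
  assumes J: "J \<noteq> {}" "k \<notin> J"
  shows "\<exists>c. \<forall>f \<in> borel_measurable borel.
    (\<integral>\<^sup>+x. f (x $ k / norm (coord_proj (insert k J) x)) \<partial>gauss) = c * (\<integral>\<^sup>+u. f u * sphere_weight (card J) u \<partial>lborel)"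
proof -
  interpret product_prob_space "\<lambda>_::'d. std_normal" by (rule product_prob_space_std_normal)
  obtain c where c: "\<And>f. f \<in> borel_measurable borel \<Longrightarrow>
    (\<integral>\<^sup>+x. f (\<Sum>i\<in>J. (x i)\<^sup>2) \<partial>(\<Pi>\<^sub>M i\<in>J. std_normal)) = c * (\<integral>\<^sup>+z. f z * chi_square_weight (card J) z \<partial>lborel)"
    using nn_integral_sum_squares_normal[OF _ J(1)] by auto
  have n: "norm (coord_proj (insert k J) x) = sqrt (\<Sum>i\<in>insert k J. (x $ i)\<^sup>2)" for x :: "real ^ 'd"
  proof -
    have "coord_proj (insert k J) x \<bullet> coord_proj (insert k J) x = (\<Sum>i\<in>UNIV. if i \<in> insert k J then (x $ i)\<^sup>2 else 0)"
      unfolding inner_vec_def by (rule sum.cong) (auto simp: power2_eq_square)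
    also have "\<dots> = (\<Sum>i\<in>insert k J. (x $ i)\<^sup>2)"
      by (subst sum.inter_restrict[symmetric]) auto
    finally show ?thesis by (simp only: norm_eq_sqrt_inner)
  qed
  have "(\<integral>\<^sup>+x. f (x $ k / norm (coord_proj (insert k J) x)) \<partial>gauss)
     = c * ennreal (1 / sqrt (2 * pi)) * (\<integral>\<^sup>+z. chi_square_weight (Suc (card J)) z \<partial>lborel) * (\<integral>\<^sup>+u. f u * sphere_weight (card J) u \<partial>lborel)"
    if [measurable]: "f \<in> borel_measurable borel" for f
  proof -
    let ?h = "\<lambda>x. f (x k / sqrt (\<Sum>i\<in>insert k J. (x i)\<^sup>2))"
    have [measurable]: "?h \<in> borel_measurable (\<Pi>\<^sub>M i\<in>insert k J. std_normal)" by measurable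
    have "(\<integral>\<^sup>+x. f (x $ k / norm (coord_proj (insert k J) x)) \<partial>gauss) = (\<integral>\<^sup>+x. ?h x \<partial>(\<Pi>\<^sub>M i\<in>UNIV. std_normal))"
      unfolding n gauss_def by (subst nn_integral_distr) auto
    \<comment> \<open>The integrand sees only the coordinates in \<open>insert k J\<close>, so the
      product measure may be replaced by its marginal there.\<close>
    also have "\<dots> = (\<integral>\<^sup>+x. ?h (restrict x (insert k J)) \<partial>(\<Pi>\<^sub>M i\<in>UNIV. std_normal))"
      by (intro nn_integral_cong) (auto intro!: arg_cong[where f=f] arg_cong2[where f="(/)"] arg_cong[where f=sqrt] sum.cong)
    also have "\<dots> = (\<integral>\<^sup>+x. ?h x \<partial>(\<Pi>\<^sub>M i\<in>insert k J. std_normal))"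
    proof -
      have "(\<Pi>\<^sub>M i\<in>insert k J. std_normal)
          = distr (\<Pi>\<^sub>M i\<in>UNIV. std_normal) (\<Pi>\<^sub>M i\<in>insert k J. std_normal) (\<lambda>x. restrict x (insert k J))"
        by (rule distr_restrict) auto
      then have "(\<integral>\<^sup>+x. ?h x \<partial>(\<Pi>\<^sub>M i\<in>insert k J. std_normal)) = integral\<^sup>N
          (distr (\<Pi>\<^sub>M i\<in>UNIV. std_normal) (\<Pi>\<^sub>M i\<in>insert k J. std_normal) (\<lambda>x. restrict x (insert k J))) ?h"
        by (rule arg_cong)
      also have "\<dots> = (\<integral>\<^sup>+x. ?h (restrict x (insert k J)) \<partial>(\<Pi>\<^sub>M i\<in>UNIV. std_normal))"
        by (rule nn_integral_distr) (auto intro!: measurable_restrict_subset)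
      finally show ?thesis by simp
    qed
    also have "\<dots> = (\<integral>\<^sup>+y. \<integral>\<^sup>+x. ?h (x(k := y)) \<partial>(\<Pi>\<^sub>M i\<in>J. std_normal) \<partial>std_normal)"
      using J by (intro product_nn_integral_insert_rev) auto
    also have "\<dots> = (\<integral>\<^sup>+y. \<integral>\<^sup>+x. f (y / sqrt (y\<^sup>2 + (\<Sum>i\<in>J. (x i)\<^sup>2))) \<partial>(\<Pi>\<^sub>M i\<in>J. std_normal) \<partial>std_normal)"
    proof (intro nn_integral_cong)
      fix x :: "'d \<Rightarrow> real" and y
      have "(\<Sum>i\<in>J. ((x(k := y)) i)\<^sup>2) = (\<Sum>i\<in>J. (x i)\<^sup>2)"
        using J by (intro sum.cong) auto
      then show "?h (x(k := y)) = f (y / sqrt (y\<^sup>2 + (\<Sum>i\<in>J. (x i)\<^sup>2)))"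
        using J by simp
    qed
    also have "\<dots> = (\<integral>\<^sup>+y. c * (\<integral>\<^sup>+z. f (y / sqrt (y\<^sup>2 + z)) * chi_square_weight (card J) z \<partial>lborel) \<partial>std_normal)"
    proof (intro nn_integral_cong)
      fix y
      show "(\<integral>\<^sup>+x. f (y / sqrt (y\<^sup>2 + (\<Sum>i\<in>J. (x i)\<^sup>2))) \<partial>(\<Pi>\<^sub>M i\<in>J. std_normal))
        = c * (\<integral>\<^sup>+z. f (y / sqrt (y\<^sup>2 + z)) * chi_square_weight (card J) z \<partial>lborel)"
        by (rule c[of "\<lambda>z. f (y / sqrt (y\<^sup>2 + z))"]) measurable
    qed
    also have "\<dots> = c * (\<integral>\<^sup>+y. \<integral>\<^sup>+z. f (y / sqrt (y\<^sup>2 + z)) * chi_square_weight (card J) z \<partial>lborel \<partial>std_normal)"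
      by (rule nn_integral_cmult) measurable
    also have "\<dots> = c * (ennreal (1 / sqrt (2 * pi)) *
        (\<integral>\<^sup>+z. (\<integral>\<^sup>+u. f u * sphere_weight (card J) u \<partial>lborel) * chi_square_weight (Suc (card J)) z \<partial>lborel))"
      by (subst nn_integral_normal_chi_square[of "\<lambda>u z. f u"]) auto
    also have "(\<integral>\<^sup>+z. (\<integral>\<^sup>+u. f u * sphere_weight (card J) u \<partial>lborel) * chi_square_weight (Suc (card J)) z \<partial>lborel)
        = (\<integral>\<^sup>+u. f u * sphere_weight (card J) u \<partial>lborel) * (\<integral>\<^sup>+z. chi_square_weight (Suc (card J)) z \<partial>lborel)"
      by (rule nn_integral_cmult) measurable
    finally show ?thesis by (simp add: mult_ac)
  qed
  then show ?thesis by blast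
qed

text \<open>The normalising constants never have to be computed: both are determined by the total mass.\<close>
lemma prob_measure_eqI_weight:
  assumes M: "prob_space M" "sets M = sets borel" and N: "prob_space N" "sets N = sets borel"
    and Mc: "\<And>f. f \<in> borel_measurable borel \<Longrightarrow> (\<integral>\<^sup>+x. f x \<partial>M) = c * (\<integral>\<^sup>+x. f x * w x \<partial>L)"
    and Nd: "\<And>f. f \<in> borel_measurable borel \<Longrightarrow> (\<integral>\<^sup>+x. f x \<partial>N) = d * (\<integral>\<^sup>+x. f x * w x \<partial>L)"
  shows "M = N"
proof -
  let ?I = "\<integral>\<^sup>+x. w x \<partial>L"
  have "c * ?I = 1" "d * ?I = 1"
    using Mc[of "\<lambda>_. 1"] Nd[of "\<lambda>_. 1"] prob_space.emeasure_space_1[OF M(1)] prob_space.emeasure_space_1[OF N(1)]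
    by auto
  \<comment> \<open>With \<open>I\<close> for the mass of the weight,
    \<open>c = c * (d * I) = d * (c * I) = d\<close>, which avoids cancellation in the extended
    nonnegative reals.\<close>
  then have "c = d"
    by (metis mult.commute mult.left_commute mult.right_neutral)
  show ?thesis
  proof (rule measure_eqI)
    fix A assume A: "A \<in> sets M"
    then have "emeasure M A = (\<integral>\<^sup>+x. indicator A x \<partial>M)" by simp
    also have "\<dots> = (\<integral>\<^sup>+x. indicator A x \<partial>N)"
      using A M(2) by (simp only: Mc Nd \<open>c = d\<close> borel_measurable_indicator)
    also have "\<dots> = emeasure N A" using A M(2) N(2) by simp
    finally show "emeasure M A = emeasure N A" .
  qed (simp add: M N)
qed

section \<open>Random signs and square roots of beta variables\<close>

lemma (in prob_space) nn_integral_rademacher: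
  fixes \<epsilon> :: "'a \<Rightarrow> real" and h :: "real \<Rightarrow> ennreal"
  assumes [measurable]: "\<epsilon> \<in> borel_measurable M" "h \<in> borel_measurable borel"
    and p: "prob {\<omega> \<in> space M. \<epsilon> \<omega> = 1} = 1 / 2" "prob {\<omega> \<in> space M. \<epsilon> \<omega> = -1} = 1 / 2"
  shows "(\<integral>\<^sup>+\<omega>. h (\<epsilon> \<omega>) \<partial>M) = ennreal (1 / 2) * (h 1 + h (-1))"
proof -
  let ?A = "{\<omega> \<in> space M. \<epsilon> \<omega> = 1}" and ?B = "{\<omega> \<in> space M. \<epsilon> \<omega> = -1}"
  have "prob (?A \<union> ?B) = prob ?A + prob ?B"
    by (rule finite_measure_Union) auto
  then have "prob (?A \<union> ?B) = 1" using p by simp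
  \<comment> \<open>The two prescribed probabilities exhaust the total mass, so almost surely no
    other value occurs.\<close>
  then have "AE \<omega> in M. \<omega> \<in> ?A \<union> ?B" by (subst (asm) prob_eq_1) auto
  then have "AE \<omega> in M. h (\<epsilon> \<omega>) = h 1 * indicator ?A \<omega> + h (-1) * indicator ?B \<omega>"
    by eventually_elim auto
  then have "(\<integral>\<^sup>+\<omega>. h (\<epsilon> \<omega>) \<partial>M) = (\<integral>\<^sup>+\<omega>. h 1 * indicator ?A \<omega> + h (-1) * indicator ?B \<omega> \<partial>M)"
    by (rule nn_integral_cong_AE)
  also have "\<dots> = h 1 * emeasure M ?A + h (-1) * emeasure M ?B"
    by (subst nn_integral_add) (auto simp: nn_integral_cmult_indicator)
  finally show ?thesis by (simp add: emeasure_eq_measure p distrib_left mult.commute)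
qed

lemma (in prob_space) nn_integral_indep_var:
  assumes ind: "indep_var borel X borel Y" and [measurable]: "case_prod f \<in> borel_measurable (borel \<Otimes>\<^sub>M borel)"
  shows "(\<integral>\<^sup>+\<omega>. f (X \<omega>) (Y \<omega>) \<partial>M) = (\<integral>\<^sup>+x. \<integral>\<^sup>+y. f x y \<partial>distr M borel Y \<partial>distr M borel X)"
proof -
  have [measurable]: "X \<in> borel_measurable M" "Y \<in> borel_measurable M"
    using ind by (auto dest: indep_var_rv1 indep_var_rv2)
  interpret Y: prob_space "distr M borel Y" by (rule prob_space_distr) measurable
  have "(\<integral>\<^sup>+\<omega>. f (X \<omega>) (Y \<omega>) \<partial>M) = (\<integral>\<^sup>+(x, y). f x y \<partial>distr M (borel \<Otimes>\<^sub>M borel) (\<lambda>\<omega>. (X \<omega>, Y \<omega>)))"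
    by (subst nn_integral_distr) auto
  also have "\<dots> = (\<integral>\<^sup>+(x, y). f x y \<partial>(distr M borel X \<Otimes>\<^sub>M distr M borel Y))"
    using ind by (simp add: indep_var_distribution_eq)
  also have "\<dots> = (\<integral>\<^sup>+x. \<integral>\<^sup>+y. f x y \<partial>distr M borel Y \<partial>distr M borel X)"
    by (subst Y.nn_integral_fst[symmetric]) auto
  finally show ?thesis .
qed

text \<open>Under \<open>t = u\<^sup>2\<close> the factor \<open>t powr (1 / 2 - 1)\<close> cancels
  against the Jacobian \<open>2 * u\<close>, up to the factor 2, and leaves the sphere weight on the
  positive half-line. The independent sign spreads it evenly over both half-lines.\<close>

lemma (in prob_space) nn_integral_signed_sqrt_beta:
  fixes \<epsilon> \<beta> :: "'a \<Rightarrow> real"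
  assumes m: "m > 0"
    and ind: "indep_var borel \<epsilon> borel \<beta>"
    and p: "prob {\<omega> \<in> space M. \<epsilon> \<omega> = 1} = 1 / 2" "prob {\<omega> \<in> space M. \<epsilon> \<omega> = -1} = 1 / 2"
    and D: "distributed M lborel \<beta> (\<lambda>t. ennreal (beta_density (1 / 2) (real m / 2) t))"
  shows "\<exists>c. \<forall>f \<in> borel_measurable borel.
    (\<integral>\<^sup>+\<omega>. f (\<epsilon> \<omega> * sqrt (\<beta> \<omega>)) \<partial>M) = c * (\<integral>\<^sup>+u. f u * sphere_weight m u \<partial>lborel)"
proof -
  have [measurable]: "\<epsilon> \<in> borel_measurable M" "\<beta> \<in> borel_measurable M"
    using ind by (auto simp: indep_var_rv1 dest: indep_var_rv1 indep_var_rv2)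
  let ?b = "beta_density (1 / 2) (real m / 2)"
  have [measurable]: "?b \<in> borel_measurable borel" unfolding beta_density_def by measurable
  define B where "B = Gamma (1 / 2 + real m / 2) / (Gamma (1 / 2) * Gamma (real m / 2))"
  have B: "B \<ge> 0" unfolding B_def using m by (intro divide_nonneg_nonneg mult_nonneg_nonneg less_imp_le Gamma_real_pos) auto
  have "(\<integral>\<^sup>+\<omega>. f (\<epsilon> \<omega> * sqrt (\<beta> \<omega>)) \<partial>M) = ennreal B * (\<integral>\<^sup>+u. f u * sphere_weight m u \<partial>lborel)"
    if [measurable]: "f \<in> borel_measurable borel" for f :: "real \<Rightarrow> ennreal"
  proof -
    interpret T: prob_space "distr M borel \<beta>" by (rule prob_space_distr) measurable
    have T: "distr M borel \<beta> = density lborel (\<lambda>t. ennreal (?b t))"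
      using distributed_distr_eq_density[OF D] by (simp cong: distr_cong)
    have "(\<integral>\<^sup>+\<omega>. f (\<epsilon> \<omega> * sqrt (\<beta> \<omega>)) \<partial>M)
        = (\<integral>\<^sup>+e. \<integral>\<^sup>+t. f (e * sqrt t) \<partial>distr M borel \<beta> \<partial>distr M borel \<epsilon>)"
      by (rule nn_integral_indep_var[OF ind]) measurable
    also have "\<dots> = (\<integral>\<^sup>+\<omega>. \<integral>\<^sup>+t. f (\<epsilon> \<omega> * sqrt t) \<partial>distr M borel \<beta> \<partial>M)"
      by (subst nn_integral_distr) auto
    also have "\<dots> = ennreal (1 / 2) * ((\<integral>\<^sup>+t. f (1 * sqrt t) \<partial>distr M borel \<beta>) + (\<integral>\<^sup>+t. f (-1 * sqrt t) \<partial>distr M borel \<beta>))"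
      by (rule nn_integral_rademacher) (measurable, (fact p)+)
    also have "\<dots> = ennreal (1 / 2) * (\<integral>\<^sup>+t. f (sqrt t) + f (- sqrt t) \<partial>distr M borel \<beta>)"
      by (subst nn_integral_add) auto
    also have "(\<integral>\<^sup>+t. f (sqrt t) + f (- sqrt t) \<partial>distr M borel \<beta>)
        = (\<integral>\<^sup>+t. ennreal (?b t) * (f (sqrt t) + f (- sqrt t)) * indicator {0<..} t \<partial>lborel)"
      unfolding T using AE_lborel_singleton[of "0::real"]
      by (subst nn_integral_density)
        (auto intro!: nn_integral_cong_AE elim!: eventually_mono simp: beta_density_def split: split_indicator)
    also have "\<dots> = (\<integral>\<^sup>+u. ennreal (?b (u\<^sup>2)) * (f (sqrt (u\<^sup>2)) + f (- sqrt (u\<^sup>2))) * ennreal (2 * u) * indicator {0<..} u \<partial>lborel)"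
      by (rule nn_integral_square_substitution) measurable
    also have "\<dots> = (\<integral>\<^sup>+u. ennreal (2 * B) * ((f u * sphere_weight m u + f (- u) * sphere_weight m (- u)) * indicator {0<..} u) \<partial>lborel)"
    proof (rule nn_integral_cong)
      fix u :: real
      show "ennreal (?b (u\<^sup>2)) * (f (sqrt (u\<^sup>2)) + f (- sqrt (u\<^sup>2))) * ennreal (2 * u) * indicator {0<..} u
        = ennreal (2 * B) * ((f u * sphere_weight m u + f (- u) * sphere_weight m (- u)) * indicator {0<..} u)"
      proof (cases "0 < u")
        case u: True
        have even: "sphere_weight m (- u) = sphere_weight m u"
          by (auto simp: sphere_weight_def split: split_indicator)
        have "ennreal (?b (u\<^sup>2)) * ennreal (2 * u) = ennreal (2 * B) * sphere_weight m u"
        proof (cases "u < 1")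
          case True
          have "(u\<^sup>2) powr (1 / 2 - 1) = 1 / u"
            using u by (simp add: powr_minus_divide powr_half_sqrt)
          then have "?b (u\<^sup>2) * (2 * u) = 2 * B * (1 - u\<^sup>2) powr (real m / 2 - 1)"
            using u True by (simp add: beta_density_def B_def power_le_one)
          moreover have "0 \<le> ?b (u\<^sup>2)"
            unfolding beta_density_def B_def[symmetric] using B by simp
          ultimately show ?thesis using u True B
            by (simp add: sphere_weight_def ennreal_mult[symmetric])
        next
          case False
          then have "u\<^sup>2 \<ge> 1" using u by (simp add: one_le_power)
          \<comment> \<open>At the endpoint 1 the density vanishes because a power of base 0 is 0,
            whatever the exponent; this agrees with the open interval in
            \<open>sphere_weight\<close>.\<close>
          then have "?b (u\<^sup>2) = 0" by (cases "u\<^sup>2 = 1") (auto simp: beta_density_def)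
          then show ?thesis using False by (simp add: sphere_weight_def)
        qed
        then have "(f u + f (- u)) * (ennreal (?b (u\<^sup>2)) * ennreal (2 * u)) = (f u + f (- u)) * (ennreal (2 * B) * sphere_weight m u)"
          by (rule arg_cong)
        then show ?thesis using u by (simp add: even distrib_left distrib_right mult_ac)
      qed simp
    qed
    also have "\<dots> = ennreal (2 * B) * (\<integral>\<^sup>+u. (f u * sphere_weight m u + f (- u) * sphere_weight m (- u)) * indicator {0<..} u \<partial>lborel)"
      by (rule nn_integral_cmult) measurable
    also have "(\<integral>\<^sup>+u. (f u * sphere_weight m u + f (- u) * sphere_weight m (- u)) * indicator {0<..} u \<partial>lborel)
      = (\<integral>\<^sup>+u. f u * sphere_weight m u \<partial>lborel)"
      by (rule nn_integral_real_symmetrize[symmetric]) measurable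
    also have "ennreal (1 / 2) * (ennreal (2 * B) * (\<integral>\<^sup>+u. f u * sphere_weight m u \<partial>lborel))
       = ennreal B * (\<integral>\<^sup>+u. f u * sphere_weight m u \<partial>lborel)"
    proof -
      have "ennreal (1 / 2) * ennreal (2 * B) = ennreal B"
        using B by (subst ennreal_mult[symmetric]) auto
      then show ?thesis by (simp only: mult.assoc[symmetric])
    qed
    finally show ?thesis .
  qed
  then show ?thesis by blast
qed

section \<open>Left invariant measures from products of reflections\<close>

lemma measurable_fixing_coset [measurable]: "fixing_coset J s \<in> sets borel"
proof -
  have "{A :: real ^ 'a ^ 'a. transpose A ** A = mat 1} \<in> sets borel"
    using measurable_sets[of "\<lambda>A :: real ^ 'a ^ 'a. transpose A ** A" borel borel "{mat 1}"]
    by (simp add: vimage_def)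
  moreover have "{A :: real ^ 'a ^ 'a. A *v axis i 1 = axis i 1} \<in> sets borel" for i
    using measurable_sets[of "\<lambda>A :: real ^ 'a ^ 'a. A *v axis i 1" borel borel "{axis i 1}"]
    by (simp add: vimage_def)
  then have "(\<Inter>i\<in>UNIV. if i \<in> J then UNIV else {A :: real ^ 'a ^ 'a. A *v axis i 1 = axis i 1}) \<in> sets borel"
    by (intro sets.finite_INT) auto
  moreover have "{A :: real ^ 'a ^ 'a. det A = s} \<in> sets borel"
    using measurable_sets[of "\<lambda>A :: real ^ 'a ^ 'a. det A" borel borel "{s}"]
    by (simp add: vimage_def)
  moreover have "fixing_coset J s = {A. transpose A ** A = mat 1} \<inter>
      (\<Inter>i\<in>UNIV. if i \<in> J then UNIV else {A. A *v axis i 1 = axis i 1}) \<inter> {A. det A = s}"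
    by (auto simp: fixing_coset_def orthogonal_matrix split: if_splits)
  ultimately show ?thesis by simp
qed

text \<open>The measure lives on all matrices and is merely concentrated on a group or coset where
  required. The integral form can be inserted directly into iterated integrals.\<close>

definition left_invariant :: "(real ^ 'd ^ 'd) set \<Rightarrow> (real ^ 'd ^ 'd) measure \<Rightarrow> bool" where
  "left_invariant G \<nu> \<longleftrightarrow> (\<forall>h \<in> G. \<forall>f \<in> borel_measurable borel. (\<integral>\<^sup>+W. f (h ** W) \<partial>\<nu>) = (\<integral>\<^sup>+W. f W \<partial>\<nu>))"

lemma left_invariantD:
  "left_invariant G \<nu> \<Longrightarrow> h \<in> G \<Longrightarrow> f \<in> borel_measurable borel \<Longrightarrow> (\<integral>\<^sup>+W. f (h ** W) \<partial>\<nu>) = (\<integral>\<^sup>+W. f W \<partial>\<nu>)"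
  by (simp add: left_invariant_def)

section \<open>One random reflection step\<close>

definition householder_step :: "'d set \<Rightarrow> 'd \<Rightarrow> (real ^ 'd ^ 'd) measure \<Rightarrow> (real ^ 'd ^ 'd) measure" where
  "householder_step J k \<nu> = distr (gauss \<Otimes>\<^sub>M \<nu>) borel
     (\<lambda>(g, W). householder k (coord_proj (insert k J) g) ** W)"

context
  fixes J :: "'d :: finite set" and k :: 'd and \<nu> :: "(real ^ 'd ^ 'd) measure"
  assumes J: "J \<noteq> {}" "k \<notin> J"
    and prob: "prob_space \<nu>" and sets [measurable_cong, simp]: "sets \<nu> = sets borel"
begin

interpretation N: prob_space \<nu> by (rule prob)
interpretation G: prob_space "gauss :: (real ^ 'd) measure" by (rule prob_space_gauss)
interpretation GN: pair_prob_space "gauss :: (real ^ 'd) measure" \<nu> ..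

lemma prob_space_householder_step: "prob_space (householder_step J k \<nu>)"
  unfolding householder_step_def by (rule GN.prob_space_distr) measurable

lemma nn_integral_householder_step:
  assumes [measurable]: "f \<in> borel_measurable borel"
  shows "(\<integral>\<^sup>+W. f W \<partial>householder_step J k \<nu>) =
    (\<integral>\<^sup>+g. \<integral>\<^sup>+W. f (householder k (coord_proj (insert k J) g) ** W) \<partial>\<nu> \<partial>gauss)"
proof -
  have "(\<integral>\<^sup>+W. f W \<partial>householder_step J k \<nu>) =
    (\<integral>\<^sup>+p. f (case p of (g, W) \<Rightarrow> householder k (coord_proj (insert k J) g) ** W) \<partial>(gauss \<Otimes>\<^sub>M \<nu>))"
    unfolding householder_step_def by (rule nn_integral_distr) measurable
  also have "\<dots> = (\<integral>\<^sup>+g. \<integral>\<^sup>+W. f (householder k (coord_proj (insert k J) g) ** W) \<partial>\<nu> \<partial>gauss)"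
    by (subst N.nn_integral_fst[symmetric]) auto
  finally show ?thesis .
qed

text \<open>Almost surely the projected Gaussian vector has a nonzero coordinate in
  \<open>J\<close>, so the reflection is genuine and flips the sign of the determinant.\<close>

lemma AE_householder_step:
  assumes "AE W in \<nu>. W \<in> fixing_coset J s"
  shows "AE W in householder_step J k \<nu>. W \<in> fixing_coset (insert k J) (- s)"
proof -
  obtain j where j: "j \<in> J" "j \<noteq> k" using J by auto
  have "AE g in gauss. AE W in \<nu>. householder k (coord_proj (insert k J) g) ** W \<in> fixing_coset (insert k J) (- s)"
    using AE_gauss_nonzero[of j]
  proof eventually_elim
    case (elim g)
    have R: "householder k (coord_proj (insert k J) g) \<in> fixing_coset (insert k J) (-1)"
      by (rule householder_in_fixing_coset[of k _ _ j]) (use j elim in auto)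
    show ?case using assms
    proof eventually_elim
      case (elim W)
      then have "W \<in> fixing_coset (insert k J) s" using fixing_coset_mono[of J "insert k J"] by blast
      then show ?case using fixing_coset_mul[of "householder k (coord_proj (insert k J) g)" "insert k J" "-1" W s] R by simp
    qed
  qed
  moreover have T: "(\<lambda>(g, W). householder k (coord_proj (insert k J) g) ** W) \<in> gauss \<Otimes>\<^sub>M \<nu> \<rightarrow>\<^sub>M borel"
    by measurable
  then have "{p \<in> space (gauss \<Otimes>\<^sub>M \<nu>). (case p of (g, W) \<Rightarrow> householder k (coord_proj (insert k J) g) ** W) \<in> fixing_coset (insert k J) (- s)} \<in> sets (gauss \<Otimes>\<^sub>M \<nu>)"
    using measurable_sets[OF T measurable_fixing_coset] by (simp add: vimage_def Int_def conj_commute)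
  ultimately have "AE p in gauss \<Otimes>\<^sub>M \<nu>. (case p of (g, W) \<Rightarrow> householder k (coord_proj (insert k J) g) ** W) \<in> fixing_coset (insert k J) (- s)"
    by (intro GN.AE_pair_measure) (simp_all only: prod.case)
  then show ?thesis
    unfolding householder_step_def by (subst AE_distr_iff) auto
qed

text \<open>By \<open>householder_transport\<close>, \<open>h\<close> times the reflection for
  \<open>g\<close> is the reflection for \<open>h *v g\<close> times an element of the smaller
  group. The invariance of \<open>\<nu>\<close> absorbs that element, and the rotation invariance of
  the Gaussian measure replaces \<open>h *v g\<close> by \<open>g\<close>.\<close>

lemma left_invariant_householder_step:
  assumes inv: "left_invariant (fixing_coset J 1) \<nu>"
  shows "left_invariant (fixing_coset (insert k J) 1) (householder_step J k \<nu>)"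
  unfolding left_invariant_def
proof (intro ballI)
  fix h :: "real ^ 'd ^ 'd" and f :: "real ^ 'd ^ 'd \<Rightarrow> ennreal"
  assume h: "h \<in> fixing_coset (insert k J) 1" and f [measurable]: "f \<in> borel_measurable borel"
  have ho: "orthogonal_matrix h" using h by (simp add: fixing_coset_def)
  obtain j where j: "j \<in> J" "j \<noteq> k" using J by auto
  let ?P = "coord_proj (insert k J) :: real ^ 'd \<Rightarrow> _"
  let ?F = "\<lambda>g. \<integral>\<^sup>+W. f (householder k (?P g) ** W) \<partial>\<nu>"
  have "(\<integral>\<^sup>+W. f (h ** W) \<partial>householder_step J k \<nu>) = (\<integral>\<^sup>+g. \<integral>\<^sup>+W. f (h ** (householder k (?P g) ** W)) \<partial>\<nu> \<partial>gauss)"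
    by (rule nn_integral_householder_step) measurable
  also have "\<dots> = (\<integral>\<^sup>+g. ?F (h *v g) \<partial>gauss)"
  proof (rule nn_integral_cong_AE)
    show "AE g in gauss. (\<integral>\<^sup>+W. f (h ** (householder k (?P g) ** W)) \<partial>\<nu>) = ?F (h *v g)"
      using AE_gauss_nonzero[of j] AE_gauss_orthogonal[OF ho, of j]
    proof eventually_elim
      case (elim g)
      have P: "?P (h *v g) = h *v ?P g" by (rule fixing_coset_coord_proj[OF h])
      have nz: "?P g $ j \<noteq> 0" "(h *v ?P g) $ j \<noteq> 0"
        using elim j by (simp_all flip: P)
      let ?H = "householder k (h *v ?P g)"
      define A where "A = ?H ** h ** householder k (?P g)"
      have A: "A \<in> fixing_coset J 1"
        unfolding A_def by (rule householder_transport[OF h _ j(2) nz(1) j(2) nz(2)]) simp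
      have "h ** householder k (?P g) = ?H ** A"
        unfolding A_def householder_def by (simp add: matrix_mul_assoc reflection_square)
      then have "(\<integral>\<^sup>+W. f (h ** (householder k (?P g) ** W)) \<partial>\<nu>) = (\<integral>\<^sup>+W. f (?H ** (A ** W)) \<partial>\<nu>)"
        by (simp add: matrix_mul_assoc)
      also have "\<dots> = (\<integral>\<^sup>+W. f (?H ** W) \<partial>\<nu>)"
        by (rule left_invariantD[OF inv A]) measurable
      finally show ?case by (simp add: P)
    qed
  qed
  also have "\<dots> = (\<integral>\<^sup>+g. ?F g \<partial>gauss)"
    by (rule nn_integral_gauss_orthogonal[OF ho]) measurable
  also have "\<dots> = (\<integral>\<^sup>+W. f W \<partial>householder_step J k \<nu>)"
    by (rule nn_integral_householder_step[symmetric]) measurable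
  finally show "(\<integral>\<^sup>+W. f (h ** W) \<partial>householder_step J k \<nu>) = (\<integral>\<^sup>+W. f W \<partial>householder_step J k \<nu>)" .
qed

lemma nn_integral_char_det_householder_step:
  assumes AE: "AE W in \<nu>. W \<in> fixing_coset J s" and f [measurable]: "f \<in> borel_measurable borel"
  shows "(\<integral>\<^sup>+W. f (char_det (insert k J) W) \<partial>householder_step J k \<nu>) =
    (\<integral>\<^sup>+g. \<integral>\<^sup>+W. f ((1 - g $ k / norm (coord_proj (insert k J) g)) * char_det J W) \<partial>\<nu> \<partial>gauss)"
proof -
  obtain j where j: "j \<in> J" using J by auto
  let ?P = "coord_proj (insert k J) :: real ^ 'd \<Rightarrow> _"
  have "(\<integral>\<^sup>+W. f (char_det (insert k J) W) \<partial>householder_step J k \<nu>) =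
    (\<integral>\<^sup>+g. \<integral>\<^sup>+W. f (char_det (insert k J) (householder k (?P g) ** W)) \<partial>\<nu> \<partial>gauss)"
    by (rule nn_integral_householder_step) measurable
  also have "\<dots> = (\<integral>\<^sup>+g. \<integral>\<^sup>+W. f ((1 - g $ k / norm (?P g)) * char_det J W) \<partial>\<nu> \<partial>gauss)"
  proof (rule nn_integral_cong_AE)
    show "AE g in gauss. (\<integral>\<^sup>+W. f (char_det (insert k J) (householder k (?P g) ** W)) \<partial>\<nu>)
       = (\<integral>\<^sup>+W. f ((1 - g $ k / norm (?P g)) * char_det J W) \<partial>\<nu>)"
      using AE_gauss_nonzero[of j]
    proof eventually_elim
      case (elim g)
      then have "?P g $ j \<noteq> 0" using j by simp
      then have nz: "?P g \<noteq> 0" by (metis zero_index)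
      show ?case
      proof (rule nn_integral_cong_AE)
        show "AE W in \<nu>. f (char_det (insert k J) (householder k (?P g) ** W)) = f ((1 - g $ k / norm (?P g)) * char_det J W)"
          using AE
        proof eventually_elim
          case (elim W)
          show ?case using char_det_householder[OF elim J(2) nz] by simp
        qed
      qed
    qed
  qed
  finally show ?thesis .
qed

end

text \<open>\<open>L m\<close> stands for the expected law of the determinant in dimension
  \<open>m\<close>, and \<open>step\<close> is the recursion that
  \<open>char_det_householder\<close> forces on it. One induction carries the coset, the invariance
  and the determinant law together.\<close>

lemma ex_left_invariant_char_det:
  fixes L :: "nat \<Rightarrow> real measure" and J :: "'d :: finite set"
  assumes L1: "L 1 = return borel 2"
    and step: "\<And>(J :: 'd set) k f. J \<noteq> {} \<Longrightarrow> k \<notin> J \<Longrightarrow> f \<in> borel_measurable borel \<Longrightarrow>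
      (\<integral>\<^sup>+g. \<integral>\<^sup>+y. f ((1 - g $ k / norm (coord_proj (insert k J) g)) * y) \<partial>L (card J) \<partial>gauss) = (\<integral>\<^sup>+y. f y \<partial>L (Suc (card J)))"
    and J: "finite J" "J \<noteq> {}"
  shows "\<exists>\<nu>. prob_space \<nu> \<and> sets \<nu> = sets borel \<and> (AE W in \<nu>. W \<in> fixing_coset J ((-1) ^ card J)) \<and>
    left_invariant (fixing_coset J 1) \<nu> \<and>
    (\<forall>f \<in> borel_measurable borel. (\<integral>\<^sup>+W. f (char_det J W) \<partial>\<nu>) = (\<integral>\<^sup>+y. f y \<partial>L (card J)))"
  using J
proof (induction rule: finite_ne_induct)
  case (singleton k)
  \<comment> \<open>The chain starts at a reflection because the identity would make every
    determinant in it 0. The determinant sign is therefore \<open>(-1) ^ card J\<close>.\<close>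
  let ?\<nu> = "return borel (reflection (axis k 1)) :: (real ^ 'd ^ 'd) measure"
  have "prob_space ?\<nu>" by (rule prob_space_return) simp
  moreover have "AE W in ?\<nu>. W \<in> fixing_coset {k} ((-1) ^ card {k})"
    by (subst AE_return) (auto simp: reflection_axis_in_fixing_coset)
  moreover have "left_invariant (fixing_coset {k} 1) ?\<nu>"
    by (simp add: left_invariant_def fixing_coset_singleton)
  moreover have "(\<integral>\<^sup>+W. f (char_det {k} W) \<partial>?\<nu>) = (\<integral>\<^sup>+y. f y \<partial>L (card {k}))"
    if [measurable]: "f \<in> borel_measurable borel" for f
    using L1 by (simp add: nn_integral_return char_det_reflection_axis)
  ultimately show ?case by (intro exI[of _ ?\<nu>]) auto
next
  case (insert k J)
  then obtain \<nu> where \<nu>: "prob_space \<nu>" "sets \<nu> = sets borel"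
    and AE: "AE W in \<nu>. W \<in> fixing_coset J ((-1) ^ card J)"
    and inv: "left_invariant (fixing_coset J 1) \<nu>"
    and L: "\<And>f. f \<in> borel_measurable borel \<Longrightarrow> (\<integral>\<^sup>+W. f (char_det J W) \<partial>\<nu>) = (\<integral>\<^sup>+y. f y \<partial>L (card J))"
    by auto
  let ?\<nu> = "householder_step J k \<nu>"
  have "(\<integral>\<^sup>+W. f (char_det (insert k J) W) \<partial>?\<nu>) = (\<integral>\<^sup>+y. f y \<partial>L (card (insert k J)))"
    if f [measurable]: "f \<in> borel_measurable borel" for f
  proof -
    have "(\<integral>\<^sup>+W. f (char_det (insert k J) W) \<partial>?\<nu>) =
      (\<integral>\<^sup>+g. \<integral>\<^sup>+W. f ((1 - g $ k / norm (coord_proj (insert k J) g)) * char_det J W) \<partial>\<nu> \<partial>gauss)"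
      by (rule nn_integral_char_det_householder_step[OF insert.hyps(2,3) \<nu> AE f])
    also have "\<dots> = (\<integral>\<^sup>+g. \<integral>\<^sup>+y. f ((1 - g $ k / norm (coord_proj (insert k J) g)) * y) \<partial>L (card J) \<partial>gauss)"
    proof (rule nn_integral_cong)
      fix g :: "real ^ 'd"
      show "(\<integral>\<^sup>+W. f ((1 - g $ k / norm (coord_proj (insert k J) g)) * char_det J W) \<partial>\<nu>)
        = (\<integral>\<^sup>+y. f ((1 - g $ k / norm (coord_proj (insert k J) g)) * y) \<partial>L (card J))"
        by (rule L[of "\<lambda>y. f ((1 - g $ k / norm (coord_proj (insert k J) g)) * y)"]) measurable
    qed
    also have "\<dots> = (\<integral>\<^sup>+y. f y \<partial>L (card (insert k J)))"
      using insert.hyps step[OF insert.hyps(2,3) f] by simp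
    finally show ?thesis .
  qed
  moreover have "AE W in ?\<nu>. W \<in> fixing_coset (insert k J) ((-1) ^ card (insert k J))"
    using AE_householder_step[OF insert.hyps(2,3) \<nu> AE] insert.hyps by simp
  ultimately show ?case
    using prob_space_householder_step[OF insert.hyps(2,3) \<nu>] left_invariant_householder_step[OF insert.hyps(2,3) \<nu> inv]
    by (intro exI[of _ ?\<nu>]) (auto simp: householder_step_def)
qed

text \<open>The double integral of \<open>f (transpose W ** S)\<close> is evaluated in both orders,
  each time using the invariance of the inner measure. The right-hand side does not mention
  \<open>\<mu>\<close>, which yields uniqueness.\<close>

lemma nn_integral_left_invariant_transpose:
  fixes \<mu> \<nu> :: "(real ^ 'd ^ 'd) measure"
  assumes \<mu>: "prob_space \<mu>" "sets \<mu> = sets borel" "AE W in \<mu>. W \<in> special_orthogonal_group" "left_invariant special_orthogonal_group \<mu>"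
    and \<nu>: "prob_space \<nu>" "sets \<nu> = sets borel" "AE W in \<nu>. W \<in> special_orthogonal_group" "left_invariant special_orthogonal_group \<nu>"
    and f [measurable]: "f \<in> borel_measurable borel"
  shows "(\<integral>\<^sup>+W. f W \<partial>\<mu>) = (\<integral>\<^sup>+W. f (transpose W) \<partial>\<nu>)"
proof -
  interpret M: prob_space \<mu> by fact
  interpret N: prob_space \<nu> by fact
  interpret MN: pair_prob_space \<mu> \<nu> ..
  note [measurable_cong] = \<mu>(2) \<nu>(2)
  have tr: "transpose W \<in> special_orthogonal_group" if "W \<in> special_orthogonal_group" for W :: "real ^ 'd ^ 'd"
    using that by (simp add: fixing_coset_transpose flip: fixing_coset_UNIV)
  have "(\<integral>\<^sup>+S. f S \<partial>\<mu>) = (\<integral>\<^sup>+W. (\<integral>\<^sup>+S. f S \<partial>\<mu>) \<partial>\<nu>)"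
    by (simp add: N.emeasure_space_1)
  also have "\<dots> = (\<integral>\<^sup>+W. \<integral>\<^sup>+S. f (transpose W ** S) \<partial>\<mu> \<partial>\<nu>)"
    using \<nu>(3)
    by (intro nn_integral_cong_AE) (auto elim!: eventually_mono intro!: left_invariantD[OF \<mu>(4), symmetric] tr)
  also have "\<dots> = (\<integral>\<^sup>+S. \<integral>\<^sup>+W. f (transpose W ** S) \<partial>\<nu> \<partial>\<mu>)"
    by (rule MN.Fubini') measurable
  also have "\<dots> = (\<integral>\<^sup>+S. \<integral>\<^sup>+W. f (transpose (transpose S ** W)) \<partial>\<nu> \<partial>\<mu>)"
    by (simp add: matrix_transpose_mul)
  also have "\<dots> = (\<integral>\<^sup>+S. (\<integral>\<^sup>+W. f (transpose W) \<partial>\<nu>) \<partial>\<mu>)"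
    using \<mu>(3)
    by (intro nn_integral_cong_AE) (auto elim!: eventually_mono intro!: left_invariantD[OF \<nu>(4), of _ "\<lambda>W. f (transpose W)"] tr)
  also have "\<dots> = (\<integral>\<^sup>+W. f (transpose W) \<partial>\<nu>)"
    by (simp add: M.emeasure_space_1)
  finally show ?thesis .
qed

section \<open>The law of the determinant\<close>

lemma nn_integral_sphere_weight_uminus:
  assumes [measurable]: "f \<in> borel_measurable borel"
  shows "(\<integral>\<^sup>+u. f (- u) * sphere_weight m u \<partial>lborel) = (\<integral>\<^sup>+u. f u * sphere_weight m u \<partial>lborel)"
proof -
  have "sphere_weight m (- u) = sphere_weight m u" for u
    by (auto simp: sphere_weight_def split: split_indicator)
  then show ?thesis
    using nn_integral_real_affine[of "\<lambda>u. f u * sphere_weight m u" "-1" 0] by simp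
qed

text \<open>Both laws are multiples of the same sphere weight. The minus sign turns the factor
  \<open>1 - u\<close> of the determinant recursion into the form
  \<open>1 + \<epsilon> * sqrt \<beta>\<close>, and is harmless since the weight is even.\<close>

lemma (in prob_space) distr_gauss_direction_eq:
  fixes \<epsilon> \<beta> :: "'a \<Rightarrow> real" and k :: "'d :: finite"
  assumes J: "J \<noteq> {}" "k \<notin> J"
    and ind: "indep_var borel \<epsilon> borel \<beta>"
    and p: "prob {\<omega> \<in> space M. \<epsilon> \<omega> = 1} = 1 / 2" "prob {\<omega> \<in> space M. \<epsilon> \<omega> = -1} = 1 / 2"
    and D: "distributed M lborel \<beta> (\<lambda>t. ennreal (beta_density (1 / 2) (real (card J) / 2) t))"
  shows "distr gauss borel (\<lambda>g. - (g $ k / norm (coord_proj (insert k J) g))) = distr M borel (\<lambda>\<omega>. \<epsilon> \<omega> * sqrt (\<beta> \<omega>))"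
proof -
  have [measurable]: "\<epsilon> \<in> borel_measurable M" "\<beta> \<in> borel_measurable M"
    using ind by (auto dest: indep_var_rv1 indep_var_rv2)
  have "card J > 0" using J by (simp add: card_gt_0_iff)
  from nn_integral_signed_sqrt_beta[OF this ind p D] obtain d where d: "\<And>f. f \<in> borel_measurable borel \<Longrightarrow>
    (\<integral>\<^sup>+\<omega>. f (\<epsilon> \<omega> * sqrt (\<beta> \<omega>)) \<partial>M) = d * (\<integral>\<^sup>+u. f u * sphere_weight (card J) u \<partial>lborel)"
    by blast
  obtain c where c: "\<And>f. f \<in> borel_measurable borel \<Longrightarrow>
    (\<integral>\<^sup>+x. f (x $ k / norm (coord_proj (insert k J) x)) \<partial>gauss) = c * (\<integral>\<^sup>+u. f u * sphere_weight (card J) u \<partial>lborel)"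
    using nn_integral_gauss_direction[OF J] by blast
  show ?thesis
  proof (rule prob_measure_eqI_weight[where c=c and d=d and w="sphere_weight (card J)" and L=lborel])
    show "prob_space (distr gauss borel (\<lambda>g. - (g $ k / norm (coord_proj (insert k J) g))))"
      by (rule prob_space.prob_space_distr[OF prob_space_gauss]) measurable
    show "prob_space (distr M borel (\<lambda>\<omega>. \<epsilon> \<omega> * sqrt (\<beta> \<omega>)))"
      by (rule prob_space_distr) measurable
    fix f :: "real \<Rightarrow> ennreal" assume [measurable]: "f \<in> borel_measurable borel"
    show "(\<integral>\<^sup>+x. f x \<partial>distr gauss borel (\<lambda>g. - (g $ k / norm (coord_proj (insert k J) g))))
        = c * (\<integral>\<^sup>+u. f u * sphere_weight (card J) u \<partial>lborel)"
      using c[of "\<lambda>u. f (- u)"] by (simp add: nn_integral_distr nn_integral_sphere_weight_uminus)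
    show "(\<integral>\<^sup>+x. f x \<partial>distr M borel (\<lambda>\<omega>. \<epsilon> \<omega> * sqrt (\<beta> \<omega>))) = d * (\<integral>\<^sup>+u. f u * sphere_weight (card J) u \<partial>lborel)"
      using d[of f] by (simp add: nn_integral_distr)
  qed simp_all
qed

lemma distr_eqI_nn_integral:
  assumes [measurable]: "X \<in> M \<rightarrow>\<^sub>M L" "Y \<in> N \<rightarrow>\<^sub>M L"
    and eq: "\<And>f. f \<in> borel_measurable L \<Longrightarrow> (\<integral>\<^sup>+\<omega>. f (X \<omega>) \<partial>M) = (\<integral>\<^sup>+\<omega>. f (Y \<omega>) \<partial>N)"
  shows "distr M L X = distr N L Y"
proof (rule measure_eqI)
  fix A assume "A \<in> sets (distr M L X)"
  then have A [measurable]: "A \<in> sets L" by simp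
  have "emeasure (distr M L X) A = (\<integral>\<^sup>+x. indicator A x \<partial>distr M L X)" using A by simp
  also have "\<dots> = (\<integral>\<^sup>+x. indicator A x \<partial>distr N L Y)"
    using eq[of "indicator A"] nn_integral_distr[OF assms(1), of "indicator A"]
      nn_integral_distr[OF assms(2), of "indicator A"] by simp
  also have "\<dots> = emeasure (distr N L Y) A" using A by simp
  finally show "emeasure (distr M L X) A = emeasure (distr N L Y) A" .
qed simp

text \<open>Haar measure lives on the trace of the Borel sets on the group; its image on all
  matrices can be compared with the measures built from reflections.\<close>

lemma haar_probability_SO_borel:
  fixes \<mu> :: "(real ^ 'd ^ 'd) measure"
  assumes "haar_probability_SO \<mu>"
  defines "\<mu>' \<equiv> distr \<mu> borel (\<lambda>W. W)"
  shows "prob_space \<mu>'" "AE W in \<mu>'. W \<in> special_orthogonal_group" "left_invariant special_orthogonal_group \<mu>'"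
    "f \<in> borel_measurable borel \<Longrightarrow> (\<integral>\<^sup>+W. f W \<partial>\<mu>') = (\<integral>\<^sup>+W. f W \<partial>\<mu>)"
proof -
  let ?G = "special_orthogonal_group :: (real ^ 'd ^ 'd) set"
  have prob: "prob_space \<mu>" and s [measurable_cong]: "sets \<mu> = sets SO_borel"
    and inv: "\<And>A. A \<in> ?G \<Longrightarrow> distr \<mu> \<mu> (\<lambda>S. A ** S) = \<mu>"
    using assms(1) by (auto simp: haar_probability_SO_def)
  have sp: "space \<mu> = ?G"
    using sets_eq_imp_space_eq[OF s] by (simp add: SO_borel_def space_restrict_space)
  have G [measurable]: "?G \<in> sets borel"
    unfolding fixing_coset_UNIV[symmetric] by (rule measurable_fixing_coset)
  have id [measurable]: "(\<lambda>W. W) \<in> \<mu> \<rightarrow>\<^sub>M borel"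
    unfolding measurable_cong_sets[OF s refl] SO_borel_def by (rule measurable_restrict_space1) measurable
  show 1: "(\<integral>\<^sup>+W. f W \<partial>\<mu>') = (\<integral>\<^sup>+W. f W \<partial>\<mu>)" if "f \<in> borel_measurable borel" for f
    unfolding \<mu>'_def using nn_integral_distr[OF id, of f] that by simp
  show "prob_space \<mu>'"
    unfolding \<mu>'_def by (rule prob_space.prob_space_distr[OF prob id])
  show "AE W in \<mu>'. W \<in> ?G"
    unfolding \<mu>'_def by (subst AE_distr_iff[OF id]) (use G sp in \<open>auto intro: AE_I2\<close>)
  show "left_invariant ?G \<mu>'"
    unfolding left_invariant_def
  proof (intro ballI)
    fix h and f :: "real ^ 'd ^ 'd \<Rightarrow> ennreal"
    assume h: "h \<in> ?G" and f [measurable]: "f \<in> borel_measurable borel"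
    have "h ** S \<in> ?G" if "S \<in> ?G" for S
      using fixing_coset_mul[of h UNIV 1 S 1] h that by (simp add: fixing_coset_UNIV)
    then have m: "(\<lambda>S. h ** S) \<in> \<mu> \<rightarrow>\<^sub>M \<mu>"
      unfolding measurable_cong_sets[OF s s] SO_borel_def
      by (intro measurable_restrict_space2 measurable_restrict_space1) (auto simp: space_restrict_space)
    have f': "f \<in> borel_measurable \<mu>"
      using measurable_compose[OF id f] by simp
    have "(\<integral>\<^sup>+W. f (h ** W) \<partial>\<mu>') = (\<integral>\<^sup>+W. f (h ** W) \<partial>\<mu>)"
      by (rule 1) measurable
    also have "\<dots> = (\<integral>\<^sup>+W. f W \<partial>distr \<mu> \<mu> (\<lambda>S. h ** S))"
      by (rule nn_integral_distr[OF m, symmetric]) (use f' in simp)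
    also have "\<dots> = (\<integral>\<^sup>+W. f W \<partial>\<mu>')" by (simp add: inv[OF h] 1)
    finally show "(\<integral>\<^sup>+W. f (h ** W) \<partial>\<mu>') = (\<integral>\<^sup>+W. f W \<partial>\<mu>')" .
  qed
qed

theorem corollary6p2:
  fixes n :: nat
    and \<mu> :: "(real ^ 'd ^ 'd) measure"
    and M :: "'a measure" and S :: "'a \<Rightarrow> real ^ 'd ^ 'd"
    and M' :: "'b measure" and \<epsilon> \<beta> :: "nat \<Rightarrow> 'b \<Rightarrow> real"
  assumes "n \<ge> 1" and "CARD('d) = 2 * n"
    and "haar_probability_SO \<mu>"
    and "prob_space M"
    and "S \<in> measurable M SO_borel" and "distr M SO_borel S = \<mu>"
    and "prob_space M'"
    and "prob_space.indep_vars M' (\<lambda>_. borel) (case_sum \<epsilon> \<beta>) ({1..2 * n} <+> {2..2 * n})"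
    and "\<And>k. k \<in> {1..2 * n} \<Longrightarrow> measure M' {\<omega> \<in> space M'. \<epsilon> k \<omega> = 1} = 1 / 2"
    and "\<And>k. k \<in> {1..2 * n} \<Longrightarrow> measure M' {\<omega> \<in> space M'. \<epsilon> k \<omega> = -1} = 1 / 2"
    and "\<And>k. k \<in> {2..2 * n} \<Longrightarrow>
           distributed M' lborel (\<beta> k) (\<lambda>t. ennreal (beta_density (1 / 2) ((real k - 1) / 2) t))"
  shows "distr M borel (\<lambda>\<omega>. det (mat 1 - S \<omega>)) =
         distr M' borel (\<lambda>\<omega>. 2 * (\<Prod>k = 2..2 * n. 1 + \<epsilon> k \<omega> * sqrt (\<beta> k \<omega>)))"
proof -
  interpret M': prob_space M' by fact
  define X where "X k \<omega> = \<epsilon> k \<omega> * sqrt (\<beta> k \<omega>)" for k \<omega>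
  \<comment> \<open>The candidate for the determinant in dimension \<open>m\<close>. For
    \<open>m = 1\<close> the product is empty and the value is 2, as for the initial
    reflection.\<close>
  define Y where "Y m \<omega> = 2 * (\<Prod>k = 2..m. 1 + X k \<omega>)" for m \<omega>
  note ind = assms(8)
  have ind_k: "M'.indep_var borel (\<epsilon> k) borel (\<beta> k)" if k: "k \<in> {2..2 * n}" for k
  proof -
    \<comment> \<open>The disjoint index blocks \<open>{Inl k}\<close> and \<open>{Inr k}\<close>
      are independent, and evaluation recovers the two variables from them.\<close>
    have "M'.indep_var
        borel ((\<lambda>f. f (Inl k)) \<circ> (\<lambda>\<omega>. restrict (\<lambda>i. case_sum \<epsilon> \<beta> i \<omega>) {Inl k}))
        borel ((\<lambda>f. f (Inr k)) \<circ> (\<lambda>\<omega>. restrict (\<lambda>i. case_sum \<epsilon> \<beta> i \<omega>) {Inr k}))"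
      using k by (intro M'.indep_var_compose[OF M'.indep_var_restrict[OF ind]]) auto
    then show ?thesis by (simp add: comp_def)
  qed
  have rv [measurable]: "\<epsilon> k \<in> borel_measurable M'" "\<beta> k \<in> borel_measurable M'" if "k \<in> {2..2 * n}" for k
    using ind_k[OF that] by (auto dest: M'.indep_var_rv1 M'.indep_var_rv2)
  have X [measurable]: "X k \<in> borel_measurable M'" if "k \<in> {2..2 * n}" for k
    using rv[OF that] unfolding X_def by measurable
  have Y [measurable]: "Y m \<in> borel_measurable M'" if "m \<le> 2 * n" for m
    unfolding Y_def by (intro borel_measurable_times borel_measurable_prod borel_measurable_add borel_measurable_const X) (use that in auto)
  \<comment> \<open>Grouping sign and beta variable of equal index into disjoint blocks makes the
    factors \<open>1 + X k\<close> independent.\<close>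
  have "M'.indep_vars (\<lambda>k. PiM {Inl k, Inr k} (\<lambda>_. borel)) (\<lambda>k \<omega>. restrict (\<lambda>i. case_sum \<epsilon> \<beta> i \<omega>) {Inl k, Inr k}) {2..2 * n}"
    by (rule M'.indep_vars_restrict[OF ind]) (auto simp: disjoint_family_on_def)
  then have "M'.indep_vars (\<lambda>_. borel)
      (\<lambda>k \<omega>. 1 + restrict (\<lambda>i. case_sum \<epsilon> \<beta> i \<omega>) {Inl k, Inr k} (Inl k)
              * sqrt (restrict (\<lambda>i. case_sum \<epsilon> \<beta> i \<omega>) {Inl k, Inr k} (Inr k))) {2..2 * n}"
    by (rule M'.indep_vars_compose2[where Y="\<lambda>k f. 1 + f (Inl k) * sqrt (f (Inr k))"]) measurable
  then have indX: "M'.indep_vars (\<lambda>_. borel) (\<lambda>k \<omega>. 1 + X k \<omega>) {2..2 * n}"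
    by (simp add: X_def)
  define L where "L m = distr M' borel (Y m)" for m
  have L1: "L 1 = return borel 2"
    unfolding L_def Y_def by simp
  have step: "(\<integral>\<^sup>+g. \<integral>\<^sup>+y. f ((1 - g $ k / norm (coord_proj (insert k J) g)) * y) \<partial>L (card J) \<partial>gauss) = (\<integral>\<^sup>+y. f y \<partial>L (Suc (card J)))"
    if J: "J \<noteq> {}" "k \<notin> J" and f [measurable]: "f \<in> borel_measurable borel" for J :: "'d set" and k f
  proof -
    let ?m = "card J"
    have "card (insert k J) \<le> 2 * n" using card_mono[of UNIV "insert k J"] assms(2) by simp
    then have m1: "Suc ?m \<le> 2 * n" using J by simp
    have m2: "?m \<ge> 1" using J by (simp add: Suc_leI card_gt_0_iff)
    have m: "Suc ?m \<in> {2..2 * n}" using m1 m2 by simp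
    note [measurable] = X[OF m]
    have [measurable]: "Y ?m \<in> borel_measurable M'" "Y (Suc ?m) \<in> borel_measurable M'" using m1 by (auto intro: Y)
    interpret Lm: prob_space "L ?m" unfolding L_def by (rule M'.prob_space_distr) measurable
    have [measurable_cong]: "sets (L ?m) = sets borel" by (simp add: L_def)
    define \<Phi> where "\<Phi> x = (\<integral>\<^sup>+y. f ((1 + x) * y) \<partial>L ?m)" for x
    have [measurable]: "\<Phi> \<in> borel_measurable borel" unfolding \<Phi>_def by measurable
    \<comment> \<open>Passing from dimension \<open>?m\<close> to \<open>Suc ?m\<close> uses the
      factor of index \<open>Suc ?m\<close>, whose beta parameter \<open>(k - 1) / 2\<close> is
      \<open>?m / 2\<close>.\<close>
    have D: "distributed M' lborel (\<beta> (Suc ?m)) (\<lambda>t. ennreal (beta_density (1 / 2) (real ?m / 2) t))"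
      using assms(11)[OF m] by simp
    have p: "M'.prob {\<omega> \<in> space M'. \<epsilon> (Suc ?m) \<omega> = 1} = 1 / 2" "M'.prob {\<omega> \<in> space M'. \<epsilon> (Suc ?m) \<omega> = - 1} = 1 / 2"
      using m assms(9,10) by auto
    have law: "distr gauss borel (\<lambda>g. - (g $ k / norm (coord_proj (insert k J) g))) = distr M' borel (X (Suc ?m))"
      unfolding X_def by (rule M'.distr_gauss_direction_eq[OF J ind_k[OF m] p D])
    have "M'.indep_vars (\<lambda>_. borel) (\<lambda>k \<omega>. 1 + X k \<omega>) (insert (Suc ?m) {2..?m})"
      using m by (intro M'.indep_vars_subset[OF indX]) auto
    then have "M'.indep_var borel (\<lambda>\<omega>. 1 + X (Suc ?m) \<omega>) borel (\<lambda>\<omega>. \<Prod>k = 2..?m. 1 + X k \<omega>)"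
      by (intro M'.indep_vars_prod) auto
    \<comment> \<open>Subtracting 1 and doubling recover \<open>X (Suc ?m)\<close> and
      \<open>Y ?m\<close> from the independent factor and product.\<close>
    then have "M'.indep_var borel ((\<lambda>x. x - 1) \<circ> (\<lambda>\<omega>. 1 + X (Suc ?m) \<omega>)) borel ((\<lambda>y. 2 * y) \<circ> (\<lambda>\<omega>. \<Prod>k = 2..?m. 1 + X k \<omega>))"
      by (rule M'.indep_var_compose) measurable
    then have XY: "M'.indep_var borel (X (Suc ?m)) borel (Y ?m)"
      by (simp add: comp_def Y_def[abs_def])
    have "(\<integral>\<^sup>+g. \<integral>\<^sup>+y. f ((1 - g $ k / norm (coord_proj (insert k J) g)) * y) \<partial>L ?m \<partial>gauss)
        = (\<integral>\<^sup>+g. \<Phi> (- (g $ k / norm (coord_proj (insert k J) g))) \<partial>gauss)"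
      by (simp add: \<Phi>_def)
    also have "\<dots> = (\<integral>\<^sup>+x. \<Phi> x \<partial>distr M' borel (X (Suc ?m)))"
      unfolding law[symmetric] by (subst nn_integral_distr) auto
    also have "\<dots> = (\<integral>\<^sup>+\<omega>. f ((1 + X (Suc ?m) \<omega>) * Y ?m \<omega>) \<partial>M')"
      unfolding \<Phi>_def L_def by (rule M'.nn_integral_indep_var[OF XY, symmetric]) measurable
    also have "\<dots> = (\<integral>\<^sup>+\<omega>. f (Y (Suc ?m) \<omega>) \<partial>M')"
      using m J by (simp add: Y_def mult_ac)
    also have "\<dots> = (\<integral>\<^sup>+y. f y \<partial>L (Suc ?m))"
      unfolding L_def by (rule nn_integral_distr[symmetric]) measurable
    finally show ?thesis .
  qed
  have "\<exists>\<nu>. prob_space \<nu> \<and> sets \<nu> = sets borel \<and> (AE W in \<nu>. W \<in> fixing_coset (UNIV :: 'd set) ((-1) ^ CARD('d))) \<and>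
    left_invariant (fixing_coset (UNIV :: 'd set) 1) \<nu> \<and>
    (\<forall>f \<in> borel_measurable borel. (\<integral>\<^sup>+W. f (char_det UNIV W) \<partial>\<nu>) = (\<integral>\<^sup>+y. f y \<partial>L (CARD('d))))"
    by (rule ex_left_invariant_char_det[where L = L, OF L1 step]) auto
  \<comment> \<open>The dimension is even, so the coset has determinant 1 and is the special
    orthogonal group itself.\<close>
  then obtain \<nu> :: "(real ^ 'd ^ 'd) measure" where \<nu>: "prob_space \<nu>" "sets \<nu> = sets borel"
      "AE W in \<nu>. W \<in> special_orthogonal_group" "left_invariant special_orthogonal_group \<nu>"
    and \<nu>_det: "\<And>f. f \<in> borel_measurable borel \<Longrightarrow> (\<integral>\<^sup>+W. f (det (mat 1 - W)) \<partial>\<nu>) = (\<integral>\<^sup>+y. f y \<partial>L (2 * n))"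
    by (auto simp: assms(2) fixing_coset_UNIV char_det_UNIV)
  note haar = haar_probability_SO_borel[OF assms(3)]
  \<comment> \<open>Comparing Haar measure with \<open>\<nu>\<close>, and \<open>\<nu>\<close> with
    itself, gives the same integral of \<open>f\<close> over transposes.\<close>
  have \<mu>_\<nu>: "(\<integral>\<^sup>+W. f W \<partial>\<mu>) = (\<integral>\<^sup>+W. f W \<partial>\<nu>)" if f: "f \<in> borel_measurable borel" for f
    using nn_integral_left_invariant_transpose[OF haar(1) _ haar(2,3) \<nu> f]
      nn_integral_left_invariant_transpose[OF \<nu> \<nu> f] haar(4)[OF f] by simp
  have S: "S \<in> borel_measurable M"
    using assms(5) unfolding SO_borel_def by (simp add: measurable_restrict_space2_iff)
  have "distr M borel (\<lambda>\<omega>. det (mat 1 - S \<omega>)) = distr M' borel (Y (2 * n))"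
  proof (rule distr_eqI_nn_integral)
    show "(\<lambda>\<omega>. det (mat 1 - S \<omega>)) \<in> borel_measurable M" using S by measurable
    show "Y (2 * n) \<in> borel_measurable M'" by (rule Y) simp
    fix f :: "real \<Rightarrow> ennreal" assume f [measurable]: "f \<in> borel_measurable borel"
    have g: "(\<lambda>W :: real ^ 'd ^ 'd. f (det (mat 1 - W))) \<in> borel_measurable SO_borel"
      unfolding SO_borel_def by (rule measurable_restrict_space1) measurable
    have "(\<integral>\<^sup>+\<omega>. f (det (mat 1 - S \<omega>)) \<partial>M) = (\<integral>\<^sup>+W. f (det (mat 1 - W)) \<partial>distr M SO_borel S)"
      using nn_integral_distr[OF assms(5), of "\<lambda>W. f (det (mat 1 - W))"] g by simp
    also have "\<dots> = (\<integral>\<^sup>+W. f (det (mat 1 - W)) \<partial>\<nu>)"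
      unfolding assms(6) by (rule \<mu>_\<nu>) measurable
    also have "\<dots> = (\<integral>\<^sup>+y. f y \<partial>L (2 * n))" by (rule \<nu>_det[OF f])
    also have "\<dots> = (\<integral>\<^sup>+\<omega>. f (Y (2 * n) \<omega>) \<partial>M')"
      unfolding L_def by (rule nn_integral_distr) (use Y in auto)
    finally show "(\<integral>\<^sup>+\<omega>. f (det (mat 1 - S \<omega>)) \<partial>M) = (\<integral>\<^sup>+\<omega>. f (Y (2 * n) \<omega>) \<partial>M')" .
  qed
  then show ?thesis by (simp add: Y_def[abs_def] X_def)
qed

end
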